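(* Let $n\ge 4$ and let $G_n$ be a $2$-connected outerplanar graph with $n$ vertices and diameter $2$, with maximum degree $\Delta(G_n)$. Then \[ \Delta(G_n)\le \chi'_{st}(G_n)\le \begin{cases} n+1, & n=5,\\ n, & n\in\{4,6,7\},\\ \Delta(G_n), & n\ge 8.\end{cases} \]
   Context: All graphs are finite and simple. A star edge coloring of a graph $G$ is a proper edge coloring of $G$ in which no path or cycle with four edges is bichromatic (colored with only two colors). The star chromatic index $\chi'_{st}(G)$ is the minimum number of colors in a star edge coloring of $G$. An outerplanar graph is a graph that can be drawn in the plane without edge crossings so that all vertices lie on the outer face. The diameter of a connected graph is the maximum distance between two of its vertices. *)

theory Defs
  imports "HOL-Analysis.Analysis"
begin

definition simple_graph :: "'a set \<Rightarrow> 'a set set \<Rightarrow> bool" where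
  "simple_graph V E \<longleftrightarrow> finite V \<and> (\<forall>e\<in>E. e \<subseteq> V \<and> card e = 2)"

definition adj :: "'a set set \<Rightarrow> 'a \<Rightarrow> 'a \<Rightarrow> bool" where
  "adj E u v \<longleftrightarrow> {u, v} \<in> E"

definition degree :: "'a set set \<Rightarrow> 'a \<Rightarrow> nat" where
  "degree E v = card {u. {v, u} \<in> E}"

definition max_degree :: "'a set \<Rightarrow> 'a set set \<Rightarrow> nat" where
  "max_degree V E = Max (degree E ` V)"

definition is_walk :: "'a set \<Rightarrow> 'a set set \<Rightarrow> 'a list \<Rightarrow> bool" where
  "is_walk V E xs \<longleftrightarrow> xs \<noteq> [] \<and> set xs \<subseteq> V \<and>
     (\<forall>i. Suc i < length xs \<longrightarrow> adj E (xs ! i) (xs ! Suc i))"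

definition connected_graph :: "'a set \<Rightarrow> 'a set set \<Rightarrow> bool" where
  "connected_graph V E \<longleftrightarrow> V \<noteq> {} \<and>
     (\<forall>u\<in>V. \<forall>v\<in>V. \<exists>xs. is_walk V E xs \<and> hd xs = u \<and> last xs = v)"

definition delete_vertex :: "'a set set \<Rightarrow> 'a \<Rightarrow> 'a set set" where
  "delete_vertex E v = {e\<in>E. v \<notin> e}"

definition two_connected :: "'a set \<Rightarrow> 'a set set \<Rightarrow> bool" where
  "two_connected V E \<longleftrightarrow> card V \<ge> 3 \<and> connected_graph V E \<and>
     (\<forall>v\<in>V. connected_graph (V - {v}) (delete_vertex E v))"

definition graph_dist :: "'a set \<Rightarrow> 'a set set \<Rightarrow> 'a \<Rightarrow> 'a \<Rightarrow> nat" where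
  "graph_dist V E u v =
     (LEAST k. \<exists>xs. is_walk V E xs \<and> hd xs = u \<and> last xs = v \<and> length xs = Suc k)"

definition diameter :: "'a set \<Rightarrow> 'a set set \<Rightarrow> nat" where
  "diameter V E = Max {graph_dist V E u v | u v. u \<in> V \<and> v \<in> V}"

definition outerplanar :: "'a set \<Rightarrow> 'a set set \<Rightarrow> bool" where
  "outerplanar V E \<longleftrightarrow>
    (\<exists>(pos :: 'a \<Rightarrow> complex) (\<gamma> :: 'a set \<Rightarrow> real \<Rightarrow> complex).
       inj_on pos V \<and>
       (\<forall>e\<in>E. arc (\<gamma> e) \<and> {pathstart (\<gamma> e), pathfinish (\<gamma> e)} = pos ` e \<and>
              (\<forall>w\<in>V - e. pos w \<notin> path_image (\<gamma> e))) \<and>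
       (\<forall>e\<in>E. \<forall>f\<in>E. e \<noteq> f \<longrightarrow> path_image (\<gamma> e) \<inter> path_image (\<gamma> f) \<subseteq> pos ` (e \<inter> f)) \<and>
       (let D = pos ` V \<union> (\<Union>e\<in>E. path_image (\<gamma> e)) in
          \<exists>C\<in>components (- D). \<not> bounded C \<and> (\<forall>v\<in>V. pos v \<in> closure C)))"

definition proper_edge_coloring :: "'a set set \<Rightarrow> ('a set \<Rightarrow> nat) \<Rightarrow> bool" where
  "proper_edge_coloring E c \<longleftrightarrow>
     (\<forall>e\<in>E. \<forall>f\<in>E. e \<noteq> f \<and> e \<inter> f \<noteq> {} \<longrightarrow> c e \<noteq> c f)"

text \<open>A path or cycle with four edges: vertices v0..v4 with consecutive ones adjacent,
  v0,v1,v2,v3 pairwise distinct and v1,v2,v3,v4 pairwise distinct (so v4 is new: a path,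
  or v4 = v0: a 4-cycle).\<close>

definition star_edge_coloring :: "'a set \<Rightarrow> 'a set set \<Rightarrow> ('a set \<Rightarrow> nat) \<Rightarrow> bool" where
  "star_edge_coloring V E c \<longleftrightarrow> proper_edge_coloring E c \<and>
     (\<forall>v0 v1 v2 v3 v4.
        v0 \<in> V \<and> v1 \<in> V \<and> v2 \<in> V \<and> v3 \<in> V \<and> v4 \<in> V \<and>
        distinct [v0, v1, v2, v3] \<and> distinct [v1, v2, v3, v4] \<and>
        {v0, v1} \<in> E \<and> {v1, v2} \<in> E \<and> {v2, v3} \<in> E \<and> {v3, v4} \<in> E \<longrightarrow>
        card (c ` {{v0, v1}, {v1, v2}, {v2, v3}, {v3, v4}}) > 2)"

definition star_chromatic_index :: "'a set \<Rightarrow> 'a set set \<Rightarrow> nat" where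
  "star_chromatic_index V E =
     (LEAST k. \<exists>c. star_edge_coloring V E c \<and> c ` E \<subseteq> {..<k})"

end

theory Submission
  imports Defs
begin

text \<open>An outerplanar graph contains no subdivision of \<open>K\<^bsub>2,3\<^esub>\<close>: of three arcs with common end points one runs
  inside the closed curve formed by the other two, so its inner vertices are not on the outer face.
  Hence a longest cycle of a 2-connected outerplanar graph is Hamiltonian (an ear would give a longer
  cycle or a \<open>K\<^bsub>2,3\<^esub>\<close>), and for at least five vertices its chords do not cross. If the diameter is 2 and
  there are at least seven vertices, then some vertex is adjacent to all others, so that the graph is a
  fan; with at most six vertices it is a subgraph of a fan or of a triangle with three ears. Explicit
  colourings of these graphs give the upper bounds.\<close>

section \<open>Theta curves and outerplanarity\<close>

text \<open>Outerplanarity enters only through the absence of a K_{2,3} subdivision, so all topology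
  is settled by one fact about three arcs. What remains is a numbered Hamiltonian cycle, and the
  distance condition becomes arithmetic on indices. Upper bounds pass to subgraphs, so only
  edge-maximal graphs need a colouring. In a fan with \<open>m\<close> spokes the spokes already
  take \<open>m\<close> colours; the rim has to reuse them, and the cyclic shift chosen here does so
  from \<open>m = 7\<close> on. Hence the bound by the maximum degree starts at eight vertices,
  while seven vertices cost one colour more than their six spokes. Six vertices are exceptional in a
  second way: a triangle with three ears has diameter 2 but no vertex adjacent to all others. Four
  vertices are exceptional because the two diagonals of a quadrilateral create no K_{2,3}; there the
  diameter excludes having both.\<close>

text \<open>Subdivisions of \<open>K\<^bsub>2,3\<^esub>\<close>: the lists \<open>p\<close>, \<open>q\<close>, \<open>r\<close> are the inner vertices of the
  three paths joining \<open>a\<close> and \<open>b\<close>.\<close>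

definition k23 :: "'a set set \<Rightarrow> bool" where
  "k23 E \<longleftrightarrow> (\<exists>a b p q r. distinct (a # b # p @ q @ r) \<and> p \<noteq> [] \<and> q \<noteq> [] \<and> r \<noteq> [] \<and>
     successively (adj E) (a # p @ [b]) \<and> successively (adj E) (a # q @ [b]) \<and>
     successively (adj E) (a # r @ [b]))"

lemma k23I:
  assumes "distinct (a # b # p @ q @ r)" "p \<noteq> []" "q \<noteq> []" "r \<noteq> []"
    "successively (adj E) (a # p @ [b])" "successively (adj E) (a # q @ [b])"
    "successively (adj E) (a # r @ [b])"
  shows "k23 E"
  using assms unfolding k23_def by blast

lemma connected_unbounded_subset_outside:
  fixes S C :: "complex set"
  assumes "connected C" "\<not> bounded C" "C \<inter> S = {}"
  shows "C \<subseteq> outside S"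
proof
  fix z assume "z \<in> C"
  with assms have "C \<subseteq> connected_component_set (- S) z"
    by (intro connected_component_maximal) auto
  then show "z \<in> outside S"
    using assms \<open>z \<in> C\<close> bounded_subset by (auto simp: outside_def)
qed

lemma Jordan_arcs:
  fixes c d :: "real \<Rightarrow> complex"
  assumes "arc c" "arc d" "pathstart c = a" "pathfinish c = b"
    "pathstart d = a" "pathfinish d = b" "path_image c \<inter> path_image d = {a, b}"
  defines "J \<equiv> path_image c \<union> path_image d"
  shows "open (inside J)" "connected (inside J)" "inside J \<noteq> {}"
    "frontier (inside J) = J" "connected (outside J)"
proof -
  have "simple_path (c +++ reversepath d)"
    by (rule simple_path_join_loop) (use assms in \<open>auto simp: arc_reversepath\<close>)
  moreover have "path_image (c +++ reversepath d) = J"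
    using assms by (simp add: path_image_join J_def)
  ultimately show "open (inside J)" "connected (inside J)" "inside J \<noteq> {}"
    "frontier (inside J) = J" "connected (outside J)"
    using Jordan_inside_outside[of "c +++ reversepath d"] assms by auto
qed

text \<open>An arc without its end points is connected and here misses \<open>J\<close>, so it stays
  in the component of its point \<open>x\<close>.\<close>

lemma arc_endless_inside:
  assumes "arc c" "x \<in> path_image c - {pathstart c, pathfinish c}" "x \<in> inside J"
    "path_image c \<inter> J \<subseteq> {pathstart c, pathfinish c}"
  shows "path_image c - {pathstart c, pathfinish c} \<subseteq> inside J"
proof -
  let ?S = "path_image c - {pathstart c, pathfinish c}"
  have "?S \<subseteq> connected_component_set (- J) x"
    using assms connected_simple_path_endless[OF arc_imp_simple_path[OF assms(1)]]
    by (intro connected_component_maximal) auto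
  then show ?thesis
    using inside_same_component[of J x] assms(3) by blast
qed

text \<open>Otherwise a point inside the first two arcs can be joined to infinity avoiding the first and the
  third arc, and avoiding the second and the third one. These two closed curves meet in the connected
  set \<open>path_image c3\<close>, so by Janiszewski's theorem it can be joined to infinity avoiding all three.\<close>

theorem theta_curve_inside:
  fixes c1 c2 c3 :: "real \<Rightarrow> complex"
  assumes "arc c1" "arc c2" "arc c3"
    and st: "pathstart c1 = a" "pathstart c2 = a" "pathstart c3 = a"
    and fi: "pathfinish c1 = b" "pathfinish c2 = b" "pathfinish c3 = b"
    and int: "path_image c1 \<inter> path_image c2 = {a, b}" "path_image c1 \<inter> path_image c3 = {a, b}"
      "path_image c2 \<inter> path_image c3 = {a, b}"
  shows "path_image c1 - {a, b} \<subseteq> inside (path_image c2 \<union> path_image c3) \<or>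
    path_image c2 - {a, b} \<subseteq> inside (path_image c1 \<union> path_image c3) \<or>
    path_image c3 - {a, b} \<subseteq> inside (path_image c1 \<union> path_image c2)"
proof (rule ccontr)
  assume neg: "\<not> ?thesis"
  define J12 J13 J23 where J: "J12 = path_image c1 \<union> path_image c2"
    "J13 = path_image c1 \<union> path_image c3" "J23 = path_image c2 \<union> path_image c3"
  \<comment> \<open>By \<open>arc_endless_inside\<close>, an arc with one inner point inside the
    curve of the other two would lie there entirely, against \<open>neg\<close>.\<close>
  have o: "(path_image c1 - {a, b}) \<inter> inside J23 = {}" "(path_image c2 - {a, b}) \<inter> inside J13 = {}"
    "(path_image c3 - {a, b}) \<inter> inside J12 = {}"
  proof -
    have "path_image c1 \<inter> J23 \<subseteq> {a, b}" "path_image c2 \<inter> J13 \<subseteq> {a, b}"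
      "path_image c3 \<inter> J12 \<subseteq> {a, b}" using int by (auto simp: J)
    note * = arc_endless_inside[OF assms(1), of _ J23, unfolded st fi, OF _ _ this(1)]
      arc_endless_inside[OF assms(2), of _ J13, unfolded st fi, OF _ _ this(2)]
      arc_endless_inside[OF assms(3), of _ J12, unfolded st fi, OF _ _ this(3)]
    show "(path_image c1 - {a, b}) \<inter> inside J23 = {}" using neg *(1) unfolding J by blast
    show "(path_image c2 - {a, b}) \<inter> inside J13 = {}" using neg *(2) unfolding J by blast
    show "(path_image c3 - {a, b}) \<inter> inside J12 = {}" using neg *(3) unfolding J by blast
  qed
  note J12 = Jordan_arcs[OF assms(1,2) st(1) fi(1) st(2) fi(2) int(1), folded J]
  note J13 = Jordan_arcs[OF assms(1,3) st(1) fi(1) st(3) fi(3) int(2), folded J]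
  note J23 = Jordan_arcs[OF assms(2,3) st(2) fi(2) st(3) fi(3) int(3), folded J]
  have "bounded (J12 \<union> J23)" 
    using assms by (auto simp: J bounded_arc_image)
  then obtain q where q: "q \<in> outside (J12 \<union> J23)"
    using outside_bounded_nonempty by blast
  have q': "q \<in> outside J12" "q \<in> outside J13" "q \<in> outside J23"
    using q outside_mono[of J12 "J12 \<union> J23"] outside_mono[of J13 "J12 \<union> J23"]
      outside_mono[of J23 "J12 \<union> J23"] by (auto simp: J)
  obtain p where p: "p \<in> inside J12" using J12 by auto
  \<comment> \<open>Stated for either arc \<open>d\<close> of \<open>J12\<close> that
    \<open>J\<close> replaces by \<open>c3\<close>. A point \<open>x\<close> of \<open>d\<close>
    lies on the boundary of \<open>inside J12\<close>, so adding it keeps that set connected; the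
    result misses \<open>J\<close> and contains \<open>x\<close>, which is outside
    \<open>J\<close>.\<close>
  have sub: "inside J12 \<subseteq> outside J" 
    if J': "J = c \<union> path_image c3" and cd: "J12 = c \<union> path_image d" "(path_image d - {a,b}) \<inter> inside J = {}"
      and d: "arc d" "pathstart d = a" "pathfinish d = b" and ab: "{a,b} \<subseteq> c" "path_image d \<inter> path_image c3 = {a,b}" 
      "c \<inter> path_image d = {a,b}" for J c d
  proof -
    obtain x where x: "x \<in> path_image d - {a,b}"
      using nonempty_simple_path_endless[OF arc_imp_simple_path[OF d(1)]] d by auto
    have xJ: "x \<notin> J" unfolding J' using x ab by blast
    then have xo: "x \<in> outside J" using x cd(2) inside_Un_outside[of J] by blast
    have "x \<in> frontier (inside J12)" using x J12(4) cd(1) by (metis Diff_iff UnI2)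
    then have "x \<in> closure (inside J12)" by (simp add: frontier_def)
    then have "connected (insert x (inside J12))"
      by (intro connected_intermediate_closure[OF J12(2)]) (auto simp: closure_subset[THEN subsetD])
    moreover have "insert x (inside J12) \<inter> J = {}"
    proof -
      have "inside J12 \<inter> J12 = {}" by (rule inside_no_overlap)
      moreover have "a \<in> J12" "b \<in> J12" "c \<subseteq> J12" using ab(1) unfolding cd(1) by blast+
      ultimately show ?thesis using xJ o(3) unfolding J' by blast
    qed
    ultimately have "insert x (inside J12) \<subseteq> connected_component_set (- J) x"
      by (intro connected_component_maximal) auto
    then show ?thesis using xo outside_same_component[of J x] by blast
  qed
  have in2: "{a, b} \<subseteq> path_image c1" "{a, b} \<subseteq> path_image c2"
    "path_image c2 \<inter> path_image c1 = {a, b}" "J12 = path_image c2 \<union> path_image c1"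
    using int(1) by (auto simp: J)
  have p13: "p \<in> outside J13"
    using sub[OF J(2) J(1) o(2) assms(2) st(2) fi(2) in2(1) int(3) int(1)] p by blast
  have p23: "p \<in> outside J23"
    using sub[OF J(3) in2(4) o(1) assms(1) st(1) fi(1) in2(2) int(2) in2(3)] p by blast
  have "connected_component (- J13) p q"
    unfolding connected_component_def
    by (rule exI[of _ "outside J13"]) (use J13(5) p13 q' outside_no_overlap[of J13] in blast)
  moreover have "connected_component (- J23) p q"
    unfolding connected_component_def
    by (rule exI[of _ "outside J23"]) (use J23(5) p23 q' outside_no_overlap[of J23] in blast)
  moreover have "J13 \<inter> J23 = path_image c3" using int unfolding J
    using pathstart_in_path_image[of c3] pathfinish_in_path_image[of c3] st fi by auto
  moreover have "compact J13" "closed J23" using assms 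
    by (auto simp: J compact_arc_image closed_arc_image)
  ultimately have "connected_component (- (J13 \<union> J23)) p q"
    using assms by (intro Janiszewski) (auto simp: connected_arc_image)
  then have "connected_component (- J12) p q"
    by (rule connected_component_of_subset) (auto simp: J)
  then show False using p q'(1) inside_same_component[of J12 p q] inside_Int_outside[of J12] by blast
qed

section \<open>Paths of the graph as arcs of the drawing\<close>

fun walk_edges :: "'a list \<Rightarrow> 'a set set" where
  "walk_edges (u # v # xs) = insert {u, v} (walk_edges (v # xs))"
| "walk_edges _ = {}"

lemma walk_edges_subset: "e \<in> walk_edges xs \<Longrightarrow> e \<subseteq> set xs"
  by (induction xs rule: walk_edges.induct) auto

lemma walk_edges_cover: "x \<in> set xs \<Longrightarrow> length xs \<ge> 2 \<Longrightarrow> \<exists>e\<in>walk_edges xs. x \<in> e"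
proof (induction xs rule: walk_edges.induct)
  case (1 u v xs)
  then show ?case by (cases xs) auto
qed auto

lemma walk_edges_in_graph: "successively (adj E) xs \<Longrightarrow> walk_edges xs \<subseteq> E"
  by (induction xs rule: walk_edges.induct) (auto simp: adj_def)

text \<open>Needed to see that two of the three paths share no edge: a common edge could only be
  \<open>{a, b}\<close>, which a path with inner vertices never traverses.\<close>

lemma ends_notin_walk_edges:
  assumes "distinct (a # b # p)" "p \<noteq> []"
  shows "{a, b} \<notin> walk_edges (a # p @ [b])"
proof -
  obtain x p' where p: "p = x # p'" using assms by (cases p) auto
  show ?thesis
    using assms walk_edges_subset[of "{a, b}" "x # p' @ [b]"] by (auto simp: p doubleton_eq_iff)
qed

text \<open>The drawing prescribes no direction for an edge, so its arc may have to be reversed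
  before joining. Later edges of the walk do not contain \<open>u\<close>, hence their arcs meet
  that of \<open>{u, v}\<close> at most in \<open>pos v\<close>; this keeps the join
  injective.\<close>

lemma arc_along_walk:
  fixes \<gamma> :: "'a set \<Rightarrow> real \<Rightarrow> complex"
  assumes "inj_on pos V"
    and arcs: "\<And>e. e \<in> E \<Longrightarrow> arc (\<gamma> e) \<and> {pathstart (\<gamma> e), pathfinish (\<gamma> e)} = pos ` e"
    and meet: "\<And>e f. e \<in> E \<Longrightarrow> f \<in> E \<Longrightarrow> e \<noteq> f \<Longrightarrow>
      path_image (\<gamma> e) \<inter> path_image (\<gamma> f) \<subseteq> pos ` (e \<inter> f)"
  shows "distinct xs \<Longrightarrow> set xs \<subseteq> V \<Longrightarrow> length xs \<ge> 2 \<Longrightarrow> successively (adj E) xs \<Longrightarrow>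
    \<exists>g. arc g \<and> pathstart g = pos (hd xs) \<and> pathfinish g = pos (last xs) \<and>
      path_image g = (\<Union>e\<in>walk_edges xs. path_image (\<gamma> e))"
proof (induction xs rule: walk_edges.induct)
  case (1 u v xs)
  have e: "{u, v} \<in> E" using 1 by (simp add: adj_def)
  have uv: "pos u \<noteq> pos v" using 1 assms(1) by (auto simp: inj_on_eq_iff)
  define g where "g = (if pathstart (\<gamma> {u, v}) = pos u then \<gamma> {u, v} else reversepath (\<gamma> {u, v}))"
  have g: "arc g" "pathstart g = pos u" "pathfinish g = pos v" "path_image g = path_image (\<gamma> {u, v})"
    using arcs[OF e] uv by (auto simp: g_def arc_reversepath doubleton_eq_iff)
  show ?case
  proof (cases xs)
    case Nil
    then show ?thesis using g by auto
  next
    case (Cons w ys)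
    with 1 obtain h where h: "arc h" "pathstart h = pos v" "pathfinish h = pos (last xs)"
      "path_image h = (\<Union>e\<in>walk_edges (v # xs). path_image (\<gamma> e))" by auto
    have "path_image g \<inter> path_image h \<subseteq> {pos v}"
    proof -
      have "path_image (\<gamma> {u, v}) \<inter> path_image (\<gamma> f) \<subseteq> {pos v}" if f: "f \<in> walk_edges (v # xs)" for f
      proof -
        have "f \<in> E" using walk_edges_in_graph[of E "v # xs"] f 1 by auto
        moreover have "u \<notin> f" using walk_edges_subset[OF f] 1 by auto
        ultimately have "path_image (\<gamma> {u, v}) \<inter> path_image (\<gamma> f) \<subseteq> pos ` ({u, v} \<inter> f)"
          by (intro meet[OF e]) auto
        then show ?thesis using \<open>u \<notin> f\<close> by auto
      qed
      then show ?thesis using g h by auto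
    qed
    then have "arc (g +++ h)" using g h by (intro arc_join) auto
    then show ?thesis using g h Cons
      by (intro exI[of _ "g +++ h"]) (auto simp: path_image_join)
  qed
qed auto

theorem outerplanar_no_k23:
  assumes "simple_graph V E" "outerplanar V E"
  shows "\<not> k23 E"
proof
  assume "k23 E"
  then obtain a b p q r where d: "distinct (a # b # p @ q @ r)" and ne: "p \<noteq> []" "q \<noteq> []" "r \<noteq> []"
    and w: "successively (adj E) (a # p @ [b])" "successively (adj E) (a # q @ [b])"
      "successively (adj E) (a # r @ [b])" unfolding k23_def by blast
  from assms(2) obtain pos :: "'a \<Rightarrow> complex" and \<gamma> C where inj: "inj_on pos V"
    and arcs: "\<And>e. e \<in> E \<Longrightarrow> arc (\<gamma> e) \<and> {pathstart (\<gamma> e), pathfinish (\<gamma> e)} = pos ` e"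
    and meet: "\<And>e f. e \<in> E \<Longrightarrow> f \<in> E \<Longrightarrow> e \<noteq> f \<Longrightarrow>
      path_image (\<gamma> e) \<inter> path_image (\<gamma> f) \<subseteq> pos ` (e \<inter> f)"
    and C: "C \<in> components (- (pos ` V \<union> (\<Union>e\<in>E. path_image (\<gamma> e))))" "\<not> bounded C"
      "\<And>v. v \<in> V \<Longrightarrow> pos v \<in> closure C"
    unfolding outerplanar_def Let_def by metis
  have EV: "e \<subseteq> V" if "e \<in> E" for e using assms(1) that by (auto simp: simple_graph_def)
  define P where "P s = (\<Union>e\<in>walk_edges (a # s @ [b]). path_image (\<gamma> e))" for s
  have inV: "set (a # s @ [b]) \<subseteq> V" if that: "successively (adj E) (a # s @ [b])" for s
  proof
    fix x assume "x \<in> set (a # s @ [b])"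
    then obtain e where "e \<in> walk_edges (a # s @ [b])" "x \<in> e"
      using walk_edges_cover[of x "a # s @ [b]"] by auto
    then show "x \<in> V" using walk_edges_in_graph[OF that] EV by blast
  qed
  have *: "\<exists>g. arc g \<and> pathstart g = pos a \<and> pathfinish g = pos b \<and> path_image g = P s"
    if "successively (adj E) (a # s @ [b])" "distinct (a # b # s)" for s
    using arc_along_walk[OF inj arcs meet, where xs = "a # s @ [b]"] inV[OF that(1)] that by (auto simp: P_def)
  obtain c1 where c1: "arc c1" "pathstart c1 = pos a" "pathfinish c1 = pos b" "path_image c1 = P p"
    using *[OF w(1)] d by auto
  obtain c2 where c2: "arc c2" "pathstart c2 = pos a" "pathfinish c2 = pos b" "path_image c2 = P q"
    using *[OF w(2)] d by auto
  obtain c3 where c3: "arc c3" "pathstart c3 = pos a" "pathfinish c3 = pos b" "path_image c3 = P r"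
    using *[OF w(3)] d by auto
  have sub: "P s \<inter> P t \<subseteq> {pos a, pos b}"
    if st: "successively (adj E) (a # s @ [b])" "successively (adj E) (a # t @ [b])"
      "distinct (a # b # s @ t)" "s \<noteq> []" for s t
  proof -
    have "path_image (\<gamma> e) \<inter> path_image (\<gamma> f) \<subseteq> {pos a, pos b}"
      if e: "e \<in> walk_edges (a # s @ [b])" and f: "f \<in> walk_edges (a # t @ [b])" for e f
    proof -
      have ef: "e \<inter> f \<subseteq> {a, b}"
        using walk_edges_subset[OF e] walk_edges_subset[OF f] st(3) by auto
      have E: "e \<in> E" "f \<in> E" using e f walk_edges_in_graph st by blast+
      have "e \<noteq> f"
      proof
        assume "e = f"
        then have "e \<subseteq> {a, b}" "card e = 2" using ef E assms(1) by (auto simp: simple_graph_def)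
        then have "e = {a, b}" using card_subset_eq[of "{a, b}" e] st by auto
        then show False using ends_notin_walk_edges[of a b s] e st by auto
      qed
      then have "path_image (\<gamma> e) \<inter> path_image (\<gamma> f) \<subseteq> pos ` (e \<inter> f)" using meet E by blast
      then show ?thesis using ef by blast
    qed
    then show ?thesis unfolding P_def by blast
  qed
  have int: "P p \<inter> P q = {pos a, pos b}" "P p \<inter> P r = {pos a, pos b}" "P q \<inter> P r = {pos a, pos b}"
  proof -
    have "{pos a, pos b} \<subseteq> P p" "{pos a, pos b} \<subseteq> P q" "{pos a, pos b} \<subseteq> P r"
      using c1 c2 c3 pathstart_in_path_image pathfinish_in_path_image by (metis empty_subsetI insert_subset)+
    moreover have "P p \<inter> P q \<subseteq> {pos a, pos b}" "P p \<inter> P r \<subseteq> {pos a, pos b}" "P q \<inter> P r \<subseteq> {pos a, pos b}"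
      using sub[OF w(1,2)] sub[OF w(1,3)] sub[OF w(2,3)] d ne by auto
    ultimately show "P p \<inter> P q = {pos a, pos b}" "P p \<inter> P r = {pos a, pos b}" "P q \<inter> P r = {pos a, pos b}"
      by blast+
  qed
  \<comment> \<open>The theta curve encloses points of an arc; the inner vertices ensure that a
    vertex of the graph is among them.\<close>
  have hit: "\<exists>x\<in>V. pos x \<in> P s - {pos a, pos b}"
    if s: "successively (adj E) (a # s @ [b])" "distinct (a # b # s)" "s \<noteq> []" for s
  proof -
    have x: "hd s \<in> set s" using s by auto
    then obtain e where e: "e \<in> walk_edges (a # s @ [b])" "hd s \<in> e"
      using walk_edges_cover[of "hd s" "a # s @ [b]"] by auto
    have "pos (hd s) \<in> pos ` e" using e by blast
    then have "pos (hd s) \<in> path_image (\<gamma> e)"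
      using arcs[of e] subsetD[OF walk_edges_in_graph[OF s(1)] e(1)]
      by (metis empty_iff insert_iff pathfinish_in_path_image pathstart_in_path_image)
    then have "pos (hd s) \<in> P s" using e by (auto simp: P_def)
    moreover have "pos (hd s) \<noteq> pos a" "pos (hd s) \<noteq> pos b"
      using inV[OF s(1)] inj x s(2) by (auto simp: inj_on_eq_iff)
    ultimately show ?thesis using inV[OF s(1)] x by auto
  qed
  \<comment> \<open>The face \<open>C\<close> is connected, unbounded and misses the drawing, so it
    lies outside this closed curve. The inside is open and therefore misses even the closure of
    \<open>C\<close>, where all vertices are.\<close>
  have out: "pos x \<notin> inside (P s \<union> P t)" if "x \<in> V" "open (inside (P s \<union> P t))"
    "successively (adj E) (a # s @ [b])" "successively (adj E) (a # t @ [b])" for x s t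
  proof
    assume x: "pos x \<in> inside (P s \<union> P t)"
    have "P s \<union> P t \<subseteq> (\<Union>e\<in>E. path_image (\<gamma> e))"
      using walk_edges_in_graph that by (fastforce simp: P_def)
    then have "C \<inter> (P s \<union> P t) = {}"
      using in_components_subset[OF C(1)] by blast
    then have "C \<subseteq> outside (P s \<union> P t)"
      using C in_components_connected by (intro connected_unbounded_subset_outside) auto
    then have "C \<inter> inside (P s \<union> P t) = {}" using inside_Int_outside by blast
    then show False using x C(3)[OF that(1)] that(2)
      by (metis disjoint_iff open_Int_closure_eq_empty Int_commute)
  qed
  have op: "open (inside (P q \<union> P r))" "open (inside (P p \<union> P r))" "open (inside (P p \<union> P q))"
    using Jordan_arcs(1)[OF c2(1) c3(1) c2(2,3) c3(2,3)] Jordan_arcs(1)[OF c1(1) c3(1) c1(2,3) c3(2,3)]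
      Jordan_arcs(1)[OF c1(1) c2(1) c1(2,3) c2(2,3)] int unfolding c1 c2 c3 by auto
  have "P p - {pos a, pos b} \<subseteq> inside (P q \<union> P r) \<or> P q - {pos a, pos b} \<subseteq> inside (P p \<union> P r) \<or>
    P r - {pos a, pos b} \<subseteq> inside (P p \<union> P q)"
    using theta_curve_inside[OF c1(1) c2(1) c3(1) c1(2) c2(2) c3(2) c1(3) c2(3) c3(3)] int c1 c2 c3 by auto
  moreover obtain x y z where "x \<in> V" "pos x \<in> P p - {pos a, pos b}" "y \<in> V" "pos y \<in> P q - {pos a, pos b}"
    "z \<in> V" "pos z \<in> P r - {pos a, pos b}" using hit[OF w(1)] hit[OF w(2)] hit[OF w(3)] d ne by auto
  ultimately show False using out[OF _ op(1) w(2,3)] out[OF _ op(2) w(1,3)] out[OF _ op(3) w(1,2)] by blast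
qed

section \<open>Hamiltonian cycles and their chords\<close>

lemma adj_sym: "adj E u v \<longleftrightarrow> adj E v u"
  by (simp add: adj_def insert_commute)

lemma successively_adj_rev: "successively (adj E) (rev xs) \<longleftrightarrow> successively (adj E) xs"
  using adj_sym[of E] by simp

lemma successively_adj_reverse:
  assumes "successively (adj E) (b # q @ [a])"
  shows "successively (adj E) (a # rev q @ [b])"
proof -
  have "a # rev q @ [b] = rev (b # q @ [a])" by simp
  then show ?thesis using assms successively_adj_rev by metis
qed

lemma is_walk_iff: "is_walk V E xs \<longleftrightarrow> xs \<noteq> [] \<and> set xs \<subseteq> V \<and> successively (adj E) xs"
  by (simp add: is_walk_def successively_conv_nth)

lemma walk_imp_distinct_walk:
  "is_walk V E xs \<Longrightarrow>
    \<exists>ys. is_walk V E ys \<and> distinct ys \<and> hd ys = hd xs \<and> last ys = last xs"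
proof (induction "length xs" arbitrary: xs rule: less_induct)
  case less
  show ?case
  proof (cases "distinct xs")
    case False
    then obtain p y q r where xs: "xs = p @ [y] @ q @ [y] @ r"
      using not_distinct_decomp by blast
    have "is_walk V E (p @ [y] @ r)"
      using less.prems by (auto simp: xs is_walk_iff successively_append_iff successively_Cons)
    moreover have "hd (p @ [y] @ r) = hd xs" "last (p @ [y] @ r) = last xs"
      by (auto simp: xs hd_append)
    ultimately show ?thesis using less.hyps[of "p @ [y] @ r"] by (auto simp: xs)
  qed (use less in auto)
qed

lemma connected_graph_path:
  assumes "connected_graph V E" "u \<in> V" "v \<in> V"
  obtains xs where "successively (adj E) xs" "set xs \<subseteq> V" "distinct xs" "xs \<noteq> []" "hd xs = u" "last xs = v"
  using assms walk_imp_distinct_walk[of V E] unfolding connected_graph_def is_walk_iff by metis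

lemma connected_graph_neighbor:
  assumes "connected_graph V E" "u \<in> V" "v \<in> V" "u \<noteq> v"
  obtains w where "w \<in> V" "w \<noteq> u" "adj E u w"
proof -
  obtain xs where xs: "successively (adj E) xs" "set xs \<subseteq> V" "distinct xs" "xs \<noteq> []" "hd xs = u" "last xs = v"
    using connected_graph_path assms by metis
  then obtain ys where "xs = u # ys" by (cases xs) auto
  with xs assms that[of "hd ys"] show thesis by (cases ys) auto
qed

lemma adj_delete_vertex: "adj (delete_vertex E x) u v \<Longrightarrow> adj E u v"
  by (auto simp: adj_def delete_vertex_def)

section \<open>Cycles and ears\<close>

definition graph_cycle :: "'a set \<Rightarrow> 'a set set \<Rightarrow> 'a list \<Rightarrow> bool" where
  "graph_cycle V E ys \<longleftrightarrow> length ys \<ge> 3 \<and> distinct ys \<and> set ys \<subseteq> V \<and> successively (adj E) ys \<and>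
    adj E (last ys) (hd ys)"

lemma graph_cycle_rotate: "graph_cycle V E (xs @ ys) \<Longrightarrow> graph_cycle V E (ys @ xs)"
  by (cases "xs = []"; cases "ys = []") (auto simp: graph_cycle_def successively_append_iff)

text \<open>A vertex \<open>u\<close> with neighbour \<open>v\<close> has another neighbour
  \<open>w\<close>, since it still has one after deletion of \<open>v\<close>; the third vertex
  \<open>x\<close> shows that the smaller graph is not \<open>u\<close> alone. A path from
  \<open>v\<close> to \<open>w\<close> avoiding \<open>u\<close> closes up through
  \<open>u\<close>.\<close>

lemma graph_cycle_exists:
  assumes "simple_graph V E" "two_connected V E"
  shows "\<exists>ys. graph_cycle V E ys"
proof -
  have V: "card V \<ge> 3" "connected_graph V E" "\<And>v. v \<in> V \<Longrightarrow> connected_graph (V - {v}) (delete_vertex E v)"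
    using assms by (auto simp: two_connected_def)
  have fin: "finite V" using assms by (simp add: simple_graph_def)
  obtain u where u: "u \<in> V" using V(2) by (auto simp: connected_graph_def)
  have "card (V - {u}) \<ge> 2" using V u fin by simp
  then obtain v' where v': "v' \<in> V - {u}" by (metis card.empty ex_in_conv not_numeral_le_zero)
  then obtain v where v: "v \<in> V" "v \<noteq> u" "adj E u v"
    using connected_graph_neighbor[OF V(2) u, of v'] by auto
  have "card (V - {u} - {v}) \<ge> 1" using V u v fin by simp
  then obtain x where x: "x \<in> V" "x \<noteq> u" "x \<noteq> v"
    by (metis DiffE card.empty ex_in_conv insertI1 not_one_le_zero)
  obtain w where w: "w \<in> V" "w \<noteq> v" "w \<noteq> u" "adj E u w"
    using connected_graph_neighbor[OF V(3)[OF v(1)], of u x] u v x adj_delete_vertex by (metis DiffE DiffI singletonD singletonI)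
  obtain xs where xs: "successively (adj (delete_vertex E u)) xs" "set xs \<subseteq> V - {u}" "distinct xs" "xs \<noteq> []"
    "hd xs = v" "last xs = w"
    using connected_graph_path[OF V(3)[OF u], of v w] v w by auto
  have "length xs \<ge> 2" using xs w by (cases xs; cases "tl xs") auto
  moreover have "successively (adj E) xs" using xs(1) by (rule successively_mono) (auto intro: adj_delete_vertex)
  ultimately have "graph_cycle V E (u # xs)" using xs u v w 
    by (auto simp: graph_cycle_def successively_Cons adj_sym)
  then show ?thesis ..
qed

text \<open>The two feet must differ, so connectivity is used twice. A path from outside first
  reaches the cycle in \<open>a\<close>, coming from \<open>x\<close>; a path from \<open>x\<close>
  that avoids \<open>a\<close> first reaches it in some \<open>b\<close>. The cycle is rotated to
  start at \<open>a\<close>, so that \<open>p\<close> and \<open>q\<close> are its two sides between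
  the feet.\<close>

lemma ear_exists:
  assumes "two_connected V E" and ys: "graph_cycle V E ys" "set ys \<noteq> V"
  obtains a p b q r where "graph_cycle V E (a # p @ [b] @ q)" "length (a # p @ [b] @ q) = length ys"
    "r \<noteq> []" "set r \<subseteq> V" "distinct r" "set r \<inter> set (a # p @ [b] @ q) = {}" "successively (adj E) (a # r @ [b])"
proof -
  have V: "connected_graph V E" "\<And>v. v \<in> V \<Longrightarrow> connected_graph (V - {v}) (delete_vertex E v)"
    using assms by (auto simp: two_connected_def)
  have ysV: "set ys \<subseteq> V" "ys \<noteq> []" using ys by (auto simp: graph_cycle_def)
  then obtain x0 where x0: "x0 \<in> V" "x0 \<notin> set ys" using ys(2) by blast
  obtain xs where xs: "successively (adj E) xs" "set xs \<subseteq> V" "xs \<noteq> []" "hd xs = x0" "last xs = hd ys"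
    using connected_graph_path[OF V(1) x0(1), of "hd ys"] ysV hd_in_set by (metis subsetD)
  have "\<exists>z\<in>set xs. z \<in> set ys" using xs ysV by (metis hd_in_set last_in_set)
  then obtain s a t where s: "xs = s @ a # t" "a \<in> set ys" "\<forall>z\<in>set s. z \<notin> set ys"
    using split_list_first_prop[of xs "\<lambda>z. z \<in> set ys"] by blast
  have sne: "s \<noteq> []" using s xs x0 by auto
  define x where "x = last s"
  have x: "x \<in> V" "x \<notin> set ys" "adj E x a"
    using s sne xs by (auto simp: x_def successively_append_iff)
  obtain ys1 ys2 where sp: "ys = ys1 @ a # ys2" using s(2) split_list by metis
  define zs where "zs = ys2 @ ys1"
  have cz: "graph_cycle V E (a # zs)" using graph_cycle_rotate[of V E ys1 "a # ys2"] ys sp zs_def by auto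
  then have zne: "zs \<noteq> []" "a \<notin> set zs" "a \<in> V" "set zs \<subseteq> V" by (auto simp: graph_cycle_def)
  have yz: "set ys = insert a (set zs)" by (auto simp: sp zs_def)
  obtain us where us: "successively (adj (delete_vertex E a)) us" "set us \<subseteq> V - {a}" "distinct us" "us \<noteq> []"
    "hd us = x" "last us = hd zs"
  proof -
    have "hd zs \<in> V - {a}" "x \<in> V - {a}" using zne x s by (auto dest: hd_in_set)
    then show thesis using connected_graph_path[OF V(2)[OF zne(3)]] that by metis
  qed
  have "\<exists>z\<in>set us. z \<in> set zs" using us zne by (metis hd_in_set last_in_set)
  then obtain r b t' where r: "us = r @ b # t'" "b \<in> set zs" "\<forall>z\<in>set r. z \<notin> set zs"
    using split_list_first_prop[of us "\<lambda>z. z \<in> set zs"] by blast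
  have rne: "r \<noteq> []" using r us x yz by auto
  have "successively (adj E) us" using us(1) by (rule successively_mono) (auto intro: adj_delete_vertex)
  then have "successively (adj E) (a # r @ [b])"
    using r us x rne by (auto simp: successively_append_iff successively_Cons adj_sym)
  moreover obtain p q where pq: "zs = p @ b # q" using r(2) split_list by metis
  moreover have "length (a # p @ [b] @ q) = length ys"
    using arg_cong[OF pq, of length] by (simp add: sp zs_def)
  moreover have "set r \<subseteq> V" "distinct r" "a \<notin> set r" using r us by auto
  ultimately show thesis
    using that[of a p b q r] cz rne r(3) by auto
qed

theorem two_connected_hamiltonian:
  assumes "simple_graph V E" "two_connected V E" "\<not> k23 E"
  shows "\<exists>ys. graph_cycle V E ys \<and> set ys = V"
proof -
  have fin: "finite V" using assms by (simp add: simple_graph_def)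
  have "length ys \<le> card V" if "graph_cycle V E ys" for ys
    using that fin by (metis graph_cycle_def card_mono distinct_card)
  then obtain ys where ys: "graph_cycle V E ys" and max: "\<And>zs. graph_cycle V E zs \<Longrightarrow> length zs \<le> length ys"
    using graph_cycle_exists[OF assms(1,2)] ex_has_greatest_nat[of "graph_cycle V E" _ length "Suc (card V)"]
    by (metis less_Suc_eq_le)
  have "set ys = V"
  proof (rule ccontr)
    assume "set ys \<noteq> V"
    then obtain a p b q r where c: "graph_cycle V E (a # p @ [b] @ q)" "length (a # p @ [b] @ q) = length ys"
      and r: "r \<noteq> []" "set r \<subseteq> V" "distinct r" "set r \<inter> set (a # p @ [b] @ q) = {}"
        "successively (adj E) (a # r @ [b])"
      using ear_exists[OF assms(2) ys] by metis
    \<comment> \<open>If one side has no inner vertex, the ear can replace that edge and lengthens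
      the cycle; otherwise both sides and the ear are three paths as in \<open>k23\<close>.\<close>
    consider "p = []" | "q = []" | "p \<noteq> []" "q \<noteq> []" by blast
    then show False
    proof cases
      case 1
      then have "graph_cycle V E (a # r @ [b] @ q)" using c r
        by (auto simp: graph_cycle_def successively_append_iff successively_Cons)
      from max[OF this] show False using c(2) r(1) 1 by (cases r) simp_all
    next
      case 2
      have "successively (adj E) (b # rev r @ [a])"
        using successively_adj_reverse[OF r(5)] .
      with 2 have "graph_cycle V E (a # p @ [b] @ rev r)" using c r
        by (cases p) (auto simp: graph_cycle_def successively_append_iff successively_Cons last_rev hd_rev hd_append)
      from max[OF this] show False using c(2) r(1) 2 by (cases r) simp_all
    next
      case 3
      have "successively (adj E) (b # q @ [a])" using c(1) 3
        by (auto simp: graph_cycle_def successively_append_iff successively_Cons)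
      then have "successively (adj E) (a # rev q @ [b])"
        by (rule successively_adj_reverse)
      moreover have "successively (adj E) (a # p @ [b])" using c(1) 3
        by (auto simp: graph_cycle_def successively_append_iff successively_Cons)
      ultimately have "k23 E" unfolding k23_def using r 3 c(1)
        by (intro exI[of _ a] exI[of _ b] exI[of _ p] exI[of _ "rev q"] exI[of _ r]) (auto simp: graph_cycle_def)
      then show False using assms by simp
    qed
  qed
  then show ?thesis using ys by blast
qed

text \<open>Three paths lead from \<open>a\<close> to \<open>b\<close>: along \<open>p\<close>; by
  the chord to \<open>c\<close> and back along \<open>q\<close>; back along \<open>s\<close> to
  \<open>d\<close> and then by the other chord. The last two have the inner vertices
  \<open>c\<close> and \<open>d\<close>, so only \<open>p\<close> must be assumed nonempty.\<close>

lemma no_crossing_aux: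
  assumes "\<not> k23 E" "graph_cycle V E (a # p @ [b] @ q @ [c] @ r @ [d] @ s)" "p \<noteq> []"
  shows "\<not> (adj E a c \<and> adj E b d)"
proof
  assume ac: "adj E a c \<and> adj E b d"
  then have ca: "adj E c a" by (simp add: adj_sym)
  note c = assms(2)[unfolded graph_cycle_def]
  have "successively (adj E) ((a # p @ [b]) @ (q @ [c] @ r @ [d] @ s))"
    "successively (adj E) ((a # p) @ (b # q @ [c]) @ (r @ [d] @ s))"
    "successively (adj E) ((a # p @ [b] @ q @ [c] @ r) @ (d # s))" using c by simp_all
  then have s: "successively (adj E) (a # p @ [b])" "successively (adj E) (b # q @ [c])"
    "successively (adj E) (d # s)" unfolding successively_append_iff by blast+
  have "successively (adj E) ((b # q @ [c]) @ [a])"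
    unfolding successively_append_iff using s ca by simp
  then have "successively (adj E) (a # (c # rev q) @ [b])"
    using successively_adj_reverse[of E b "q @ [c]" a] by simp
  moreover have "adj E (last (d # s)) a" using c by simp
  then have "successively (adj E) ((b # d # s) @ [a])"
    unfolding successively_append_iff using s ac by simp
  then have "successively (adj E) (a # (rev s @ [d]) @ [b])"
    using successively_adj_reverse[of E b "d # s" a] by simp
  moreover have "distinct (a # b # p @ (c # rev q) @ (rev s @ [d]))" using c by auto
  ultimately have "k23 E" using k23I[OF _ assms(3) _ _ s(1)] by blast
  then show False using assms by simp
qed

text \<open>A fifth vertex makes one of the four gaps nonempty, and a rotation brings that gap to
  the front.\<close>

lemma no_crossing:
  assumes "\<not> k23 E" and c: "graph_cycle V E (a # p @ [b] @ q @ [c] @ r @ [d] @ s)"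
    and "length (a # p @ [b] @ q @ [c] @ r @ [d] @ s) \<ge> 5"
  shows "\<not> (adj E a c \<and> adj E b d)"
proof -
  have r: "graph_cycle V E (b # q @ [c] @ r @ [d] @ s @ [a] @ p)" 
    "graph_cycle V E (c # r @ [d] @ s @ [a] @ p @ [b] @ q)"
    "graph_cycle V E (d # s @ [a] @ p @ [b] @ q @ [c] @ r)"
    using graph_cycle_rotate[of V E "a # p" "[b] @ q @ [c] @ r @ [d] @ s"]
      graph_cycle_rotate[of V E "a # p @ [b] @ q" "[c] @ r @ [d] @ s"]
      graph_cycle_rotate[of V E "a # p @ [b] @ q @ [c] @ r" "[d] @ s"] c by auto
  have "p \<noteq> [] \<or> q \<noteq> [] \<or> r \<noteq> [] \<or> s \<noteq> []" using assms(3) by auto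
  then show ?thesis
    using no_crossing_aux[OF assms(1) c] no_crossing_aux[OF assms(1) r(1)] no_crossing_aux[OF assms(1) r(2)]
      no_crossing_aux[OF assms(1) r(3)] adj_sym[of E] by blast
qed

lemma split_at_four:
  assumes "i < j" "j < k" "k < l" "l < length ys"
  obtains o' p q r s where "ys = o' @ [ys ! i] @ p @ [ys ! j] @ q @ [ys ! k] @ r @ [ys ! l] @ s"
proof -
  have split: "\<exists>p s. xs = p @ [xs ! m] @ s \<and> p = take m xs \<and> s = drop (Suc m) xs" 
    if "m < length xs" for xs :: "'a list" and m
    using that id_take_nth_drop by fastforce
  have "ys = take l ys @ [ys ! l] @ drop (Suc l) ys"
    using split[of l ys] assms by auto
  moreover have "take l ys = take k ys @ [ys ! k] @ drop (Suc k) (take l ys)"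
    using split[of k "take l ys"] assms by (auto simp: min_def)
  moreover have "take k ys = take j ys @ [ys ! j] @ drop (Suc j) (take k ys)"
    using split[of j "take k ys"] assms by (auto simp: min_def)
  moreover have "take j ys = take i ys @ [ys ! i] @ drop (Suc i) (take j ys)"
    using split[of i "take j ys"] assms by (auto simp: min_def)
  ultimately show thesis using that by (metis append.assoc)
qed

lemma graph_cycle_noncrossing:
  assumes "\<not> k23 E" "graph_cycle V E ys" "length ys \<ge> 5" "i < j" "j < k" "k < l" "l < length ys"
  shows "\<not> (adj E (ys ! i) (ys ! k) \<and> adj E (ys ! j) (ys ! l))"
proof -
  obtain o' p q r s where sp: "ys = o' @ [ys ! i] @ p @ [ys ! j] @ q @ [ys ! k] @ r @ [ys ! l] @ s"
    using split_at_four[OF assms(4-7)] by blast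
  have "graph_cycle V E (ys ! i # p @ [ys ! j] @ q @ [ys ! k] @ r @ [ys ! l] @ (s @ o'))"
    using graph_cycle_rotate[of V E o' "[ys ! i] @ p @ [ys ! j] @ q @ [ys ! k] @ r @ [ys ! l] @ s"] assms(2) sp by simp
  moreover have "length (ys ! i # p @ [ys ! j] @ q @ [ys ! k] @ r @ [ys ! l] @ (s @ o')) = length ys"
    by (subst sp) simp
  ultimately show ?thesis using no_crossing[OF assms(1)] assms(3) by simp
qed

section \<open>Diameter two\<close>

lemma diameter_two_common_neighbor:
  assumes "simple_graph V E" "connected_graph V E" "diameter V E = 2"
    and uv: "u \<in> V" "v \<in> V" "u \<noteq> v" "\<not> adj E u v"
  shows "\<exists>w\<in>V. adj E u w \<and> adj E w v"
proof -
  define P where "P k \<longleftrightarrow> (\<exists>xs. is_walk V E xs \<and> hd xs = u \<and> last xs = v \<and> length xs = Suc k)" for k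
  have "finite V" using assms by (simp add: simple_graph_def)
  then have "finite {graph_dist V E u v | u v. u \<in> V \<and> v \<in> V}"
    by (simp add: setcompr_eq_image[symmetric] finite_image_set2)
  then have "graph_dist V E u v \<le> 2"
    unfolding assms(3)[symmetric] diameter_def using uv by (intro Max_ge) auto
  moreover have gd: "graph_dist V E u v = (LEAST k. P k)"
    by (simp add: graph_dist_def P_def)
  moreover obtain xs where "is_walk V E xs" "hd xs = u" "last xs = v"
    using assms unfolding connected_graph_def by blast
  then have "P (length xs - 1)" unfolding P_def is_walk_def by (intro exI[of _ xs]) auto
  then have "P (LEAST k. P k)" by (rule LeastI)
  ultimately obtain k where "P k" "k \<le> 2" by metis
  then obtain xs where xs: "is_walk V E xs" "hd xs = u" "last xs = v" "length xs \<le> 3"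
    unfolding P_def by auto
  consider "xs = []" | x where "xs = [x]" | x y where "xs = [x, y]" | x y z where "xs = [x, y, z]"
    using xs(4) by (metis (no_types) One_nat_def Suc_le_mono length_0_conv length_Suc_conv le_SucE le_zero_eq numeral_3_eq_3)
  then show ?thesis using xs uv by cases (auto simp: is_walk_iff)
qed

lemma diameter_two_nonadjacent:
  assumes "simple_graph V E" "V \<noteq> {}" "diameter V E = 2"
  shows "\<exists>u\<in>V. \<exists>v\<in>V. u \<noteq> v \<and> \<not> adj E u v"
proof (rule ccontr)
  assume neg: "\<not> ?thesis"
  have le: "graph_dist V E u v \<le> 1" if "u \<in> V" "v \<in> V" for u v
  proof (cases "u = v")
    case True
    then have "graph_dist V E u v \<le> 0" unfolding graph_dist_def
      using that by (intro Least_le exI[of _ "[u]"]) (auto simp: is_walk_iff)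
    then show ?thesis by simp
  next
    case False
    then show ?thesis unfolding graph_dist_def
      using that neg by (intro Least_le exI[of _ "[u, v]"]) (auto simp: is_walk_iff)
  qed
  have "finite V" using assms by (simp add: simple_graph_def)
  then have "finite {graph_dist V E u v | u v. u \<in> V \<and> v \<in> V}"
    by (simp add: finite_image_set2)
  moreover have "{graph_dist V E u v | u v. u \<in> V \<and> v \<in> V} \<noteq> {}" using assms(2) by auto
  ultimately have "diameter V E \<le> 1" unfolding diameter_def using le by (subst Max_le_iff) auto
  then show False using assms(3) by simp
qed

section \<open>A vertex adjacent to all others\<close>

text \<open>As \<open>0\<close> has only the neighbours \<open>1\<close> and \<open>n - 1\<close>, every other vertex is adjacent to one of these
  two. If neither of them is adjacent to all, then the absence of crossings puts two of \<open>1\<close>, \<open>2\<close>, \<open>n - 2\<close>,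
  \<open>n - 1\<close> at distance at least three.\<close>

lemma dominating_index:
  fixes A :: "nat \<Rightarrow> nat \<Rightarrow> bool"
  assumes n: "n \<ge> 7" and sym: "\<And>i j. A i j \<Longrightarrow> A j i" and irr: "\<And>i. \<not> A i i"
    and cyc: "\<And>i. Suc i < n \<Longrightarrow> A i (Suc i)" "A 0 (n - 1)"
    and nc: "\<And>i j k l. \<lbrakk>i < j; j < k; k < l; l < n; A i k; A j l\<rbrakk> \<Longrightarrow> False"
    and diam: "\<And>i j. \<lbrakk>i < n; j < n; i \<noteq> j; \<not> A i j\<rbrakk> \<Longrightarrow> \<exists>w<n. A i w \<and> A w j"
    and ear: "\<And>j. j < n \<Longrightarrow> A 0 j \<Longrightarrow> j = 1 \<or> j = n - 1"
  shows "\<exists>h<n. \<forall>j<n. j \<noteq> h \<longrightarrow> A h j"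
proof -
  define b where "b = n - 1"
  have b: "n = Suc b" "b \<ge> 6" using n by (auto simp: b_def)
  have A01: "A 0 1" "A 1 2" "A 0 b" "A (b - 1) b"
    using cyc(1)[of 0] cyc(1)[of 1] cyc(2) cyc(1)[of "b - 1"] b by (auto simp: numeral_2_eq_2)
  have ear': "\<not> A 0 j" "\<not> A j 0" if "1 < j" "j < b" for j using ear[of j] sym[of j 0] that b by auto
  have mid: "A 1 i \<or> A i b" if "2 \<le> i" "i < b" for i
  proof -
    have "\<exists>w<n. A 0 w \<and> A w i" by (rule diam) (use ear'[of i] that b in auto)
    then obtain w where "w < n" "A 0 w" "A w i" by blast
    then show ?thesis using ear[of w] b sym by auto
  qed
  consider "\<And>i. 2 \<le> i \<Longrightarrow> i < b \<Longrightarrow> A 1 i" | "\<And>i. 2 \<le> i \<Longrightarrow> i < b \<Longrightarrow> A i b"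
    | i j where "2 \<le> i" "i < b" "\<not> A 1 i" "2 \<le> j" "j < b" "\<not> A j b" by blast
  then show ?thesis
  proof cases
    case 1
    show ?thesis
    proof (cases "A 1 b")
      case True
      have "A 1 j" if "j < n" "j \<noteq> 1" for j
      proof -
        consider "j = 0" | "2 \<le> j" "j < b" | "j = b" using \<open>j < n\<close> \<open>j \<noteq> 1\<close> b by linarith
        then show ?thesis using 1 True sym[OF A01(1)] by cases auto
      qed
      then show ?thesis using b by (intro exI[of _ 1]) auto
    next
      case False
      \<comment> \<open>\<open>A 1 3\<close> leaves 2 only the neighbours 1 and 3. The first is not
        adjacent to \<open>b\<close> here, and \<open>A 1 4\<close> separates the second from
        \<open>b\<close>, so 2 and \<open>b\<close> violate \<open>diam\<close>.\<close>
      have n2: "\<not> A 2 j" if "3 < j" "j < n" for j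
        using nc[of 1 2 3 j] 1[of 3] that b by auto
      have "\<exists>w<n. A 2 w \<and> A w b" by (rule diam) (use n2 b in auto)
      then obtain w where w: "w < n" "A 2 w" "A w b" by blast
      then have "w = 3 \<or> w = 0 \<or> w = 1" using n2[of w] irr[of 2] 
        by (metis One_nat_def Suc_1 Suc_lessI less_one linorder_neqE_nat numeral_3_eq_3)
      moreover have "\<not> A 3 b" using nc[of 1 3 4 b] 1[of 4] b by auto
      ultimately show ?thesis using w ear'[of 2] False b by auto
    qed
  next
    case 2
    show ?thesis
    proof (cases "A 1 b")
      case True
      have "A b j" if "j < n" "j \<noteq> b" for j
      proof -
        consider "j = 0" | "j = 1" | "2 \<le> j" "j < b" using \<open>j < n\<close> \<open>j \<noteq> b\<close> b by linarith
        then show ?thesis using 2 True sym A01 by cases auto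
      qed
      then show ?thesis using b by (intro exI[of _ b]) auto
    next
      case False
      \<comment> \<open>Mirror image: \<open>A 2 b\<close> leaves 1 only the neighbours 0 and 2, and
        \<open>A 3 b\<close> separates 2 from \<open>b - 1\<close>, so 1 and \<open>b - 1\<close>
        violate \<open>diam\<close>.\<close>
      have n2: "\<not> A 1 j" if "2 < j" "j < b" for j
        using nc[of 1 2 j b] 2[of 2] that b by auto
      have "\<exists>w<n. A 1 w \<and> A w (b - 1)" by (rule diam) (use n2[of "b - 1"] b in auto)
      then obtain w where w: "w < n" "A 1 w" "A w (b - 1)" by blast
      then have "w = 0 \<or> w = 2" using n2[of w] irr[of 1] False b
        by (metis One_nat_def Suc_1 Suc_lessI less_SucE less_one linorder_neqE_nat)
      moreover have "3 < b - 1" using b by simp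
      then have "\<not> A 2 (b - 1)" using nc[of 2 3 "b - 1" b] 2[of 3] b by auto
      ultimately show ?thesis using w ear'[of "b - 1"] b by auto
    qed
  next
    case 3
    \<comment> \<open>Here 2 and \<open>b - 1\<close> have no common neighbour: \<open>i\<close> and
      \<open>j\<close> rule out \<open>A 1 (b - 1)\<close> and \<open>A 2 b\<close>, the chord from
      3 to 1 or \<open>b\<close> stops chords from 2 beyond 3, and the one from \<open>b - 2\<close>
      rules out \<open>A 3 (b - 1)\<close>.\<close>
    have i: "A i b" and j: "A 1 j" using mid 3 by auto
    have n1: "\<not> A 1 (b - 1)"
    proof -
      have "i = b - 1 \<or> i < b - 1" using 3 by linarith
      then show ?thesis using nc[of 1 i "b - 1" b] i 3 b by auto
    qed
    have n2: "\<not> A 2 b" using nc[of 1 2 j b] j 3 b by (cases "j = 2") auto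
    have a3: "A 1 3 \<or> A 3 b" and ab: "A 1 (b - 2) \<or> A (b - 2) b" using mid b by auto
    have nw: "\<not> A 2 w" if "3 < w" "w < b" for w
      using a3 nc[of 1 2 3 w] nc[of 2 3 w b] that b by auto
    \<comment> \<open>Seven vertices matter here: for \<open>b = 5\<close> the indices 3 and
      \<open>b - 2\<close> coincide, and 3 can be adjacent to both 2 and \<open>b - 1\<close>, as in
      the triangle with three ears.\<close>
    have b3: "3 < b - 1" "3 < b - 2" "b - 2 < b - 1" "b - 1 < b" "b - 1 < n" using b by simp_all
    have n3: "\<not> A 3 (b - 1)"
      using ab nc[of 1 3 "b - 2" "b - 1"] nc[of 3 "b - 2" "b - 1" b] b b3 by auto
    have "\<exists>w<n. A 2 w \<and> A w (b - 1)" by (rule diam) (use nw[of "b - 1"] b b3 in auto)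
    then obtain w where w: "w < n" "A 2 w" "A w (b - 1)" by blast
    have "w \<noteq> 0" "w \<noteq> 1" "w \<noteq> 2" "w \<noteq> 3" "w \<noteq> b" 
      by (rule notI; use w ear'[of 2] n1 n2 n3 irr b in simp)+
    then show ?thesis using nw[of w] w b by auto
  qed
qed

text \<open>Among adjacent indices at least two apart take a closest pair \<open>i\<close>,
  \<open>i + d\<close>; the edge from 0 to \<open>n - 1\<close> shows that there is one. Another
  neighbour of \<open>i + 1\<close> would give a crossing with this pair or, inside it, a closer
  pair.\<close>

lemma ear_index:
  fixes A :: "nat \<Rightarrow> nat \<Rightarrow> bool"
  assumes n: "n \<ge> 3" and sym: "\<And>i j. A i j \<Longrightarrow> A j i" and irr: "\<And>i. \<not> A i i"
    and "A 0 (n - 1)"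
    and nc: "\<And>i j k l. \<lbrakk>i < j; j < k; k < l; l < n; A i k; A j l\<rbrakk> \<Longrightarrow> False"
  shows "\<exists>i. Suc (Suc i) < n \<and> (\<forall>j<n. A (Suc i) j \<longrightarrow> j = i \<or> j = Suc (Suc i))"
proof -
  define P where "P d \<longleftrightarrow> d \<ge> 2 \<and> (\<exists>i. i + d < n \<and> A i (i + d))" for d
  have "P (n - 1)" unfolding P_def using assms by (intro conjI exI[of _ 0]) auto
  then have "P (LEAST d. P d)" and min: "\<And>d. d < (LEAST d. P d) \<Longrightarrow> \<not> P d"
    by (auto intro: LeastI dest: not_less_Least)
  then obtain d i where d: "d \<ge> 2" "i + d < n" "A i (i + d)" and min: "\<And>e. e < d \<Longrightarrow> \<not> P e"
    unfolding P_def by blast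
  have "j = i \<or> j = Suc (Suc i)" if j: "j < n" "A (Suc i) j" for j
  proof (rule ccontr)
    assume neg: "\<not> (j = i \<or> j = Suc (Suc i))"
    have "j \<noteq> Suc i" using j irr by auto
    with neg consider "j < i" | "Suc (Suc i) < j" "j \<le> i + d" | "i + d < j" by linarith
    then show False
    proof cases
      case 1
      then show False using nc[of j i "Suc i" "i + d"] sym j d by auto
    next
      case 2
      then have "P (j - Suc i)" unfolding P_def using j by (intro conjI exI[of _ "Suc i"]) auto
      then show False using min[of "j - Suc i"] 2 d by auto
    next
      case 3
      then show False using nc[of i "Suc i" "i + d" j] j d by auto
    qed
  qed
  then show ?thesis using d by (intro exI[of _ i]) auto
qed

lemma graph_cycle_rotate_hd:
  assumes "graph_cycle V E ys" "i < length ys"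
  obtains zs where "graph_cycle V E zs" "set zs = set ys" "length zs = length ys"
    "\<And>j. j < length ys \<Longrightarrow> zs ! j = ys ! ((i + j) mod length ys)"
proof
  have eq: "rotate i ys = drop i ys @ take i ys"
    using assms(2) by (simp add: rotate_drop_take)
  show "graph_cycle V E (rotate i ys)"
    unfolding eq using graph_cycle_rotate[of V E "take i ys" "drop i ys"] assms(1) by simp
qed (use nth_rotate in auto)

lemma graph_cycle_adj:
  assumes "graph_cycle V E ys"
  shows "Suc i < length ys \<Longrightarrow> adj E (ys ! i) (ys ! Suc i)" "adj E (ys ! 0) (ys ! (length ys - 1))"
proof -
  have "ys \<noteq> []" "adj E (hd ys) (last ys)" using assms adj_sym[of E "hd ys"] by (auto simp: graph_cycle_def)
  then show "adj E (ys ! 0) (ys ! (length ys - 1))" by (simp add: last_conv_nth hd_conv_nth)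
qed (use assms in \<open>auto simp: graph_cycle_def successively_conv_nth\<close>)

theorem diameter_two_dominating:
  assumes g: "simple_graph V E" "connected_graph V E" "diameter V E = 2" "\<not> k23 E"
    and ys: "graph_cycle V E ys" "set ys = V" "length ys \<ge> 7"
  shows "\<exists>h\<in>V. \<forall>v\<in>V. v \<noteq> h \<longrightarrow> adj E h v"
proof -
  have irr: "\<not> adj E v v" for v using g(1) by (auto simp: simple_graph_def adj_def)
  have "\<exists>i. Suc (Suc i) < length ys \<and> (\<forall>j<length ys. adj E (ys ! Suc i) (ys ! j) \<longrightarrow> j = i \<or> j = Suc (Suc i))"
    by (rule ear_index) (use ys irr graph_cycle_adj[OF ys(1)] graph_cycle_noncrossing[OF g(4) ys(1)] adj_sym[of E] in auto)
  then obtain i where i: "Suc (Suc i) < length ys"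
    "\<And>j. j < length ys \<Longrightarrow> adj E (ys ! Suc i) (ys ! j) \<Longrightarrow> j = i \<or> j = Suc (Suc i)" by blast
  \<comment> \<open>The rotation puts the vertex found by \<open>ear_index\<close> at index 0, as
    \<open>dominating_index\<close> requires.\<close>
  obtain zs where zs: "graph_cycle V E zs" "set zs = set ys" "length zs = length ys"
    "\<And>j. j < length ys \<Longrightarrow> zs ! j = ys ! ((Suc i + j) mod length ys)"
    using graph_cycle_rotate_hd[OF ys(1), of "Suc i"] i(1) by auto
  have "\<exists>h<length zs. \<forall>j<length zs. j \<noteq> h \<longrightarrow> adj E (zs ! h) (zs ! j)"
  proof (rule dominating_index)
    show "\<exists>w<length zs. adj E (zs ! j) (zs ! w) \<and> adj E (zs ! w) (zs ! k)"
      if "j < length zs" "k < length zs" "j \<noteq> k" "\<not> adj E (zs ! j) (zs ! k)" for j k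
    proof -
      have "zs ! j \<noteq> zs ! k" using that zs(1) by (simp add: graph_cycle_def nth_eq_iff_index_eq)
      then show ?thesis
        using diameter_two_common_neighbor[OF g(1-3), of "zs ! j" "zs ! k"] that zs(2) ys(2)
        by (metis in_set_conv_nth)
    qed
    show "j = 1 \<or> j = length zs - 1" if j: "j < length zs" "adj E (zs ! 0) (zs ! j)" for j
    proof -
      have "(Suc i + j) mod length ys = i \<or> (Suc i + j) mod length ys = Suc (Suc i)"
      proof (rule i(2))
        show "(Suc i + j) mod length ys < length ys" using i(1) by (intro mod_less_divisor) linarith
        show "adj E (ys ! Suc i) (ys ! ((Suc i + j) mod length ys))"
        proof -
          have "0 < length ys" using i(1) by linarith
          then show ?thesis using j zs(3) zs(4)[of 0] zs(4)[of j] i(1) by auto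
        qed
      qed
      moreover have "(Suc i + j) mod length ys = (if Suc i + j < length ys then Suc i + j else Suc i + j - length ys)"
        using j zs(3) i(1) by (simp add: mod_if) linarith
      ultimately show ?thesis using j zs(3) i(1) by (auto split: if_splits)
    qed
  qed (use zs ys irr graph_cycle_adj[OF zs(1)] graph_cycle_noncrossing[OF g(4) zs(1)] adj_sym[of E] in auto)
  then show ?thesis using zs(2) ys(2) by (metis in_set_conv_nth)
qed

section \<open>Star edge colourings\<close>

text \<open>The index is a \<open>LEAST\<close>, so some star edge colouring must exist before
  anything follows about an optimal one; giving all edges different colours provides it. The edges
  at a vertex then need different colours.\<close>

lemma max_degree_le_star_chromatic_index:
  assumes "simple_graph V E" "V \<noteq> {}"
  shows "max_degree V E \<le> star_chromatic_index V E"
proof -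
  have fV: "finite V" and E2: "\<And>e. e \<in> E \<Longrightarrow> e \<subseteq> V \<and> card e = 2"
    using assms(1) by (auto simp: simple_graph_def)
  have fE: "finite E" using E2 by (intro finite_subset[OF _ finite_Pow_iff[THEN iffD2, OF fV]]) auto
  obtain c0 :: "'a set \<Rightarrow> nat" and m where c0: "c0 ` E = {i. i < m}" "inj_on c0 E"
    using finite_imp_inj_to_nat_seg[OF fE] by metis
  have "star_edge_coloring V E c0"
    unfolding star_edge_coloring_def proper_edge_coloring_def
  proof (intro conjI allI impI ballI)
    fix e f assume "e \<in> E" "f \<in> E" "e \<noteq> f \<and> e \<inter> f \<noteq> {}"
    then show "c0 e \<noteq> c0 f" using c0(2) by (auto simp: inj_on_def)
  next
    fix v0 v1 v2 v3 v4
    assume *: "v0 \<in> V \<and> v1 \<in> V \<and> v2 \<in> V \<and> v3 \<in> V \<and> v4 \<in> V \<and>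
        distinct [v0, v1, v2, v3] \<and> distinct [v1, v2, v3, v4] \<and>
        {v0, v1} \<in> E \<and> {v1, v2} \<in> E \<and> {v2, v3} \<in> E \<and> {v3, v4} \<in> E"
    let ?S = "{{v0, v1}, {v1, v2}, {v2, v3}, {v3, v4}}"
    have "card (c0 ` ?S) = card ?S"
      using * by (intro card_image inj_on_subset[OF c0(2)]) auto
    moreover have "card {{v0, v1}, {v1, v2}, {v2, v3}} = 3"
      using * by (auto simp: doubleton_eq_iff card_insert_if)
    moreover have "card {{v0, v1}, {v1, v2}, {v2, v3}} \<le> card ?S" by (intro card_mono) auto
    ultimately show "2 < card (c0 ` ?S)" by linarith
  qed
  then have "\<exists>c. star_edge_coloring V E c \<and> c ` E \<subseteq> {..<m}" using c0 by auto
  then have "\<exists>c. star_edge_coloring V E c \<and> c ` E \<subseteq> {..<star_chromatic_index V E}"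
    unfolding star_chromatic_index_def by (rule LeastI)
  then obtain c where c: "proper_edge_coloring E c" "c ` E \<subseteq> {..<star_chromatic_index V E}"
    by (auto simp: star_edge_coloring_def)
  have "degree E v \<le> star_chromatic_index V E" for v
  proof -
    have "inj_on (\<lambda>u. c {v, u}) {u. {v, u} \<in> E}"
    proof (rule inj_onI, rule ccontr)
      fix u w assume uw: "u \<in> {u. {v, u} \<in> E}" "w \<in> {u. {v, u} \<in> E}" "c {v, u} = c {v, w}" "u \<noteq> w"
      then have "{v, u} \<noteq> {v, w}" by (auto simp: doubleton_eq_iff)
      then show False
        using c(1)[unfolded proper_edge_coloring_def, rule_format, of "{v, u}" "{v, w}"] uw by auto
    qed
    moreover have "(\<lambda>u. c {v, u}) ` {u. {v, u} \<in> E} \<subseteq> {..<star_chromatic_index V E}" using c(2) by auto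
    ultimately show ?thesis unfolding degree_def using card_inj_on_le[of _ _ "{..<star_chromatic_index V E}"] by fastforce
  qed
  then show ?thesis unfolding max_degree_def using fV assms(2) by (subst Max_le_iff) auto
qed

text \<open>\<open>A\<close> may be any larger graph on indices, even with more vertices, so one
  colouring serves all subgraphs. In a proper colouring four consecutive edges are bichromatic only
  if the colours alternate, whence the form of \<open>star\<close>.\<close>

lemma star_chromatic_index_le:
  fixes A :: "nat \<Rightarrow> nat \<Rightarrow> bool" and col :: "nat \<Rightarrow> nat \<Rightarrow> nat"
  assumes g: "simple_graph V E" and ys: "distinct ys" "set ys = V"
    and A: "\<And>i j. i < length ys \<Longrightarrow> j < length ys \<Longrightarrow> adj E (ys ! i) (ys ! j) \<Longrightarrow> A i j"
    and sym: "\<And>i j. col i j = col j i"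
    and bound: "\<And>i j. A i j \<Longrightarrow> col i j < k"
    and proper: "\<And>i j l. \<lbrakk>A i j; A j l; i \<noteq> l\<rbrakk> \<Longrightarrow> col i j \<noteq> col j l"
    and star: "\<And>h i j l m. \<lbrakk>A h i; A i j; A j l; A l m; distinct [h, i, j, l]; distinct [i, j, l, m];
      col h i = col j l; col i j = col l m\<rbrakk> \<Longrightarrow> False"
  shows "star_chromatic_index V E \<le> k"
proof -
  define idx where "idx v = (THE i. i < length ys \<and> ys ! i = v)" for v
  have idx: "idx v < length ys" "ys ! idx v = v" if "v \<in> V" for v
  proof -
    have "\<exists>!i. i < length ys \<and> ys ! i = v"
      using that ys by (metis in_set_conv_nth nth_eq_iff_index_eq)
    from theI'[OF this] show "idx v < length ys" "ys ! idx v = v" by (auto simp: idx_def)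
  qed
  define c where "c e = (THE x. \<exists>u v. e = {u, v} \<and> x = col (idx u) (idx v))" for e
  have c: "c {u, v} = col (idx u) (idx v)" for u v
    unfolding c_def by (rule the_equality) (auto simp: doubleton_eq_iff sym)
  have E: "u \<in> V \<and> v \<in> V \<and> u \<noteq> v \<and> A (idx u) (idx v)" if "{u, v} \<in> E" for u v
  proof -
    have "{u, v} \<subseteq> V" "card {u, v} = 2" using g that by (auto simp: simple_graph_def)
    then show ?thesis using A[of "idx u" "idx v"] idx that by (auto simp: adj_def card_insert_if split: if_splits)
  qed
  have inj: "idx u = idx v \<longleftrightarrow> u = v" if "u \<in> V" "v \<in> V" for u v using idx that by metis
  have pr: "c {u, v} \<noteq> c {v, w}" if "{u, v} \<in> E" "{v, w} \<in> E" "u \<noteq> w" for u v w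
    unfolding c using proper[of "idx u" "idx v" "idx w"] E[OF that(1)] E[OF that(2)] that(3) inj by auto
  have "proper_edge_coloring E c"
    unfolding proper_edge_coloring_def
  proof (intro ballI impI)
    fix e f assume ef: "e \<in> E" "f \<in> E" "e \<noteq> f \<and> e \<inter> f \<noteq> {}"
    then obtain v where v: "v \<in> e" "v \<in> f" by blast
    have "card e = 2" "card f = 2" using g ef by (auto simp: simple_graph_def)
    then obtain u w where "e = {u, v}" "f = {v, w}"
      using v unfolding card_2_iff by (metis insertE insert_commute singletonD)
    then show "c e \<noteq> c f" using pr[of u v w] ef by (auto simp: insert_commute)
  qed
  moreover have "card (c ` {{v0, v1}, {v1, v2}, {v2, v3}, {v3, v4}}) > 2"
    if d: "distinct [v0, v1, v2, v3]" "distinct [v1, v2, v3, v4]"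
      and e: "{v0, v1} \<in> E" "{v1, v2} \<in> E" "{v2, v3} \<in> E" "{v3, v4} \<in> E" for v0 v1 v2 v3 v4
  proof -
    have p: "c {v0, v1} \<noteq> c {v1, v2}" "c {v1, v2} \<noteq> c {v2, v3}" "c {v2, v3} \<noteq> c {v3, v4}"
      using pr e d by auto
    have "\<not> (c {v0, v1} = c {v2, v3} \<and> c {v1, v2} = c {v3, v4})"
      unfolding c using star[of "idx v0" "idx v1" "idx v2" "idx v3" "idx v4"] 
        E[OF e(1)] E[OF e(2)] E[OF e(3)] E[OF e(4)] d inj by auto
    then show ?thesis using p by (auto simp: card_insert_if)
  qed
  ultimately have "star_edge_coloring V E c" unfolding star_edge_coloring_def by blast
  moreover have "c ` E \<subseteq> {..<k}"
  proof
    fix x assume "x \<in> c ` E"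
    then obtain e where e: "e \<in> E" "x = c e" by blast
    then have "card e = 2" using g by (auto simp: simple_graph_def)
    then obtain u v where "e = {u, v}" by (auto simp: card_2_iff)
    then show "x \<in> {..<k}" using e bound E by (auto simp: c)
  qed
  ultimately show ?thesis unfolding star_chromatic_index_def by (intro Least_le) blast
qed

section \<open>The cyclic colouring of a fan\<close>

definition fan_adj :: "nat \<Rightarrow> nat \<Rightarrow> nat \<Rightarrow> bool" where
  "fan_adj n i j \<longleftrightarrow> i < n \<and> j < n \<and> i \<noteq> j \<and> (i = 0 \<or> j = 0 \<or> j = Suc i \<or> i = Suc j)"

text \<open>The hub is \<open>0\<close>. With the spoke to \<open>j\<close> coloured \<open>j - 1\<close>, the rim edge from \<open>j\<close> to \<open>j + 1\<close> gets
  colour \<open>j - 1 + 3\<close> modulo \<open>m\<close>; the shift by 3 works as soon as \<open>m \<ge> 7\<close>.\<close>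

definition fan_col :: "nat \<Rightarrow> nat \<Rightarrow> nat \<Rightarrow> nat" where
  "fan_col m i j = (if i = 0 then j - 1 else if j = 0 then i - 1
     else if min i j + 2 < m then min i j + 2 else min i j + 2 - m)"

text \<open>What matters about \<open>f = fan_col m x y\<close>, stated without subtraction to suit linear arithmetic.\<close>

definition fan_edge_col :: "nat \<Rightarrow> nat \<Rightarrow> nat \<Rightarrow> nat \<Rightarrow> bool" where
  "fan_edge_col m x y f \<longleftrightarrow> x \<le> m \<and> y \<le> m \<and>
    (x = 0 \<and> y = f + 1 \<or> y = 0 \<and> x = f + 1 \<or>
     x > 0 \<and> y = x + 1 \<and> (f = x + 2 \<or> f + m = x + 2) \<or>
     y > 0 \<and> x = y + 1 \<and> (f = y + 2 \<or> f + m = y + 2))"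

lemma fan_edge_col_sym: "fan_edge_col m x y f \<longleftrightarrow> fan_edge_col m y x f"
  unfolding fan_edge_col_def by blast

lemma fan_edge_col_spoke: "fan_edge_col m 0 y f \<Longrightarrow> y > 0 \<Longrightarrow> y = f + 1"
  by (auto simp: fan_edge_col_def)

lemma fan_edge_col_rim:
  assumes "fan_edge_col m x y f" "x > 0" "y > 0"
  obtains "y = x + 1" "f = x + 2" "y \<le> m" | "y = x + 1" "f + m = x + 2" "y \<le> m" | "x = y + 1" "f = y + 2" "x \<le> m" | "x = y + 1" "f + m = y + 2" "x \<le> m"
  using assms by (auto simp: fan_edge_col_def)

text \<open>A spoke followed by two rim edges: the spoke has colour \<open>j - 1\<close>, the second
  rim edge \<open>j + 3\<close> or \<open>j\<close> modulo \<open>m\<close>, and these differ by 4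
  or 1.\<close>

lemma fan_star_end:
  assumes "fan_edge_col m 0 j c2" "fan_edge_col m j l c1" "fan_edge_col m l p c2"
    and "j > 0" "l > 0" "p > 0" "j \<noteq> p" "m \<ge> 7"
  shows False
  using assms(4-) fan_edge_col_spoke[OF assms(1,4)]
  by (rule_tac fan_edge_col_rim[OF assms(2,4,5)]; rule_tac fan_edge_col_rim[OF assms(3,5,6)]) linarith+

text \<open>The hub is the middle vertex, and this case is the origin of \<open>m \<ge> 7\<close>.
  The equal colours force \<open>l - i\<close> and also \<open>i - l\<close> to be 2 or 3 modulo
  \<open>m\<close>; adding them, \<open>m\<close> would divide 4, 5 or 6.\<close>

lemma fan_star_mid:
  assumes "fan_edge_col m h i c1" "fan_edge_col m 0 i c2" "fan_edge_col m 0 l c1" "fan_edge_col m l p c2"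
    and "h > 0" "i > 0" "l > 0" "p > 0" "m \<ge> 7" "i \<noteq> l"
  shows False
  using assms(5-) fan_edge_col_spoke[OF assms(2,6)] fan_edge_col_spoke[OF assms(3,7)]
  by (rule_tac fan_edge_col_rim[OF assms(1,5,6)]; rule_tac fan_edge_col_rim[OF assms(4,7,8)]) linarith+

text \<open>Distinct vertices force the rim edges to run in one direction, so the colours of the
  first and the third differ by 2 modulo \<open>m\<close>.\<close>

lemma fan_rim_path:
  assumes e: "fan_edge_col m h i c" "fan_edge_col m i j c2" "fan_edge_col m j l c"
    and pos: "h > 0" "i > 0" "j > 0" "l > 0" and "m \<ge> 7" "h \<noteq> j" "i \<noteq> l"
  shows False
proof -
  have "(i = h + 1 \<and> j = i + 1 \<and> l = j + 1) \<or> (h = i + 1 \<and> i = j + 1 \<and> j = l + 1)"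
    using assms by (auto simp: fan_edge_col_def)
  then show False
    using assms(8)
    by (rule_tac fan_edge_col_rim[OF e(1) pos(1,2)]; rule_tac fan_edge_col_rim[OF e(3) pos(3,4)]) linarith+
qed

text \<open>Unless three consecutive rim edges occur, both ends are the hub: a four-cycle, where
  \<open>c2\<close> would be both the colour of the spoke to \<open>l\<close> and that of the rim
  edge \<open>i j\<close>, which differ by 1 or 4 modulo \<open>m\<close>.\<close>

lemma fan_star_rim:
  assumes e: "fan_edge_col m h i c1" "fan_edge_col m i j c2" "fan_edge_col m j l c1" "fan_edge_col m l p c2"
    and pos: "i > 0" "j > 0" "l > 0" and m: "m \<ge> 7" and d: "h \<noteq> j" "i \<noteq> l" "j \<noteq> p"
  shows False
proof -
  consider "h > 0" | "p > 0" | "h = 0" "p = 0" by blast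
  then show False
  proof cases
    case 1
    then show False using fan_rim_path[OF e(1-3)] pos m d by simp
  next
    case 2
    then show False using fan_rim_path[OF e(2-4)] pos m d by simp
  next
    case 3
    then have "i = c1 + 1" "l = c2 + 1"
      using fan_edge_col_spoke e(1,4) fan_edge_col_sym pos by blast+
    then show False using m d(2)
      by (rule_tac fan_edge_col_rim[OF e(2) pos(1,2)]; rule_tac fan_edge_col_rim[OF e(3) pos(2,3)]) linarith+
  qed
qed

lemma fan_star:
  assumes e: "fan_edge_col m h i c1" "fan_edge_col m i j c2" "fan_edge_col m j l c1" "fan_edge_col m l p c2"
    and d: "distinct [h, i, j, l]" "distinct [i, j, l, p]" and m: "m \<ge> 7"
  shows False
proof -
  note s = fan_edge_col_sym
  consider "i = 0" | "j = 0" | "l = 0" | "i > 0" "j > 0" "l > 0" by blast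
  then show False
  proof cases
    case 1
    then show False using fan_star_end[of m j c2 l c1 p] e d m by simp
  next
    case 2
    then show False using fan_star_mid[of m h i c1 c2 l p] e d m s[of m i 0] by simp
  next
    case 3
    then show False using fan_star_end[of m j c1 i c2 h] e d m s[of m 0 j] s[of m i j] s[of m h i] by simp
  next
    case 4
    then show False using fan_star_rim[OF e] d m by simp
  qed
qed

text \<open>At a rim vertex \<open>j\<close> only the colours \<open>j - 1\<close>,
  \<open>j + 1\<close> and \<open>j + 2\<close> modulo \<open>m\<close> occur.\<close>

lemma fan_proper:
  assumes e: "fan_edge_col m i j c" "fan_edge_col m j l c" "i \<noteq> j" "j \<noteq> l" "i \<noteq> l" "m \<ge> 5"
  shows False
proof -
  have *: False if "fan_edge_col m 0 j c" "fan_edge_col m j l c" "j > 0" "l > 0" for l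
    using fan_edge_col_spoke[OF that(1,3)] that(3,4) assms(6)
    by (rule_tac fan_edge_col_rim[OF that(2-4)]) linarith+
  consider "j = 0" | "i = 0" | "l = 0" | "i > 0" "j > 0" "l > 0" by blast
  then show False
  proof cases
    case 1
    then show False using e fan_edge_col_spoke[of m l c] fan_edge_col_spoke[of m i c] fan_edge_col_sym[of m i 0] by simp
  next
    case 2
    then show False using e *[of l] by simp
  next
    case 3
    then show False using e *[of i] fan_edge_col_sym[of m i j] fan_edge_col_sym[of m j 0] by simp
  next
    case 4
    then show False using e(3-6)
      by (rule_tac fan_edge_col_rim[OF e(1) 4(1,2)]; rule_tac fan_edge_col_rim[OF e(2) 4(2,3)]) linarith+
  qed
qed

lemma fan_col_edge:
  assumes "fan_adj (Suc m) x y" "m \<ge> 3"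
  shows "fan_edge_col m x y (fan_col m x y)" "fan_col m x y < m" "x \<noteq> y"
proof -
  have xy: "x \<le> m" "y \<le> m" "x \<noteq> y" "x = 0 \<or> y = 0 \<or> y = Suc x \<or> x = Suc y"
    using assms(1) by (auto simp: fan_adj_def)
  then consider "x = 0" "y > 0" | "y = 0" "x > 0" | "y = Suc x" "x > 0" | "x = Suc y" "y > 0"
    by linarith
  then have "fan_edge_col m x y (fan_col m x y) \<and> fan_col m x y < m"
    using xy(1,2) assms(2) by cases (simp_all add: fan_edge_col_def fan_col_def, linarith+)
  then show "fan_edge_col m x y (fan_col m x y)" "fan_col m x y < m" "x \<noteq> y" using xy(3) by auto
qed

text \<open>\<open>m\<close> may exceed the number of spokes: seven vertices have six spokes but are
  coloured with \<open>m = 7\<close>.\<close>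

lemma fan_index_large:
  assumes g: "simple_graph V E" and ys: "distinct ys" "set ys = V"
    and fan: "\<And>i j. i < length ys \<Longrightarrow> j < length ys \<Longrightarrow> adj E (ys ! i) (ys ! j) \<Longrightarrow> fan_adj (length ys) i j"
    and m: "length ys \<le> Suc m" "m \<ge> 7"
  shows "star_chromatic_index V E \<le> m"
proof (rule star_chromatic_index_le[OF g ys, of "fan_adj (Suc m)" "fan_col m"])
  show "fan_adj (Suc m) i j" if "i < length ys" "j < length ys" "adj E (ys ! i) (ys ! j)" for i j
    using fan[OF that] m by (auto simp: fan_adj_def)
  show fan_col_sym: "fan_col m i j = fan_col m j i" for i j by (auto simp: fan_col_def min.commute)
  have edge: "fan_edge_col m x y (fan_col m x y)" "fan_col m x y < m" "x \<noteq> y"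
    if "fan_adj (Suc m) x y" for x y
    using fan_col_edge[OF that] m by simp_all
  show "fan_col m i j < m" if "fan_adj (Suc m) i j" for i j
    using edge(2)[OF that] .
  show "fan_col m i j \<noteq> fan_col m j l" if "fan_adj (Suc m) i j" "fan_adj (Suc m) j l" "i \<noteq> l" for i j l
    using fan_proper[of m i j "fan_col m i j" l] edge(1,3)[OF that(1)] edge(1,3)[OF that(2)] that(3) m by fastforce
  show False if fan: "fan_adj (Suc m) h i" "fan_adj (Suc m) i j" "fan_adj (Suc m) j l" "fan_adj (Suc m) l p"
    and d: "distinct [h, i, j, l]" "distinct [i, j, l, p]"
    and c: "fan_col m h i = fan_col m j l" "fan_col m i j = fan_col m l p"
    for h i j l p
    using fan_star[OF edge(1)[OF fan(1)] edge(1)[OF fan(2)] edge(1)[OF fan(3), folded c(1)]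
      edge(1)[OF fan(4), folded c(2)] d m(2)] .
qed

section \<open>Colourings of small graphs by matrices\<close>

text \<open>Edge colourings as symmetric matrices: an entry \<open>0\<close> means that there is no edge, an entry \<open>c + 1\<close> means colour \<open>c\<close>.\<close>

definition star_matrix :: "nat \<Rightarrow> nat list list \<Rightarrow> bool" where
  "star_matrix k M \<longleftrightarrow> (let I = [0..<length M]; c = (\<lambda>i j. M ! i ! j) in
     list_all (\<lambda>i. list_all (\<lambda>j. c i j = c j i \<and> c i j \<le> k \<and> (c i j > 0 \<longrightarrow>
       list_all (\<lambda>l. c j l > 0 \<and> l \<noteq> i \<longrightarrow> c i j \<noteq> c j l \<and>
         list_all (\<lambda>h. c h i = c j l \<and> h \<noteq> j \<and> h \<noteq> l \<longrightarrow>
           list_all (\<lambda>p. c l p = c i j \<longrightarrow> p = i \<or> p = j) I) I) I)) I) I)"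

lemma star_matrix_index:
  assumes g: "simple_graph V E" and ys: "distinct ys" "set ys = V"
    and M: "star_matrix k M" "length ys \<le> length M"
    and adj: "\<And>i j. i < length ys \<Longrightarrow> j < length ys \<Longrightarrow> adj E (ys ! i) (ys ! j) \<Longrightarrow> M ! i ! j > 0"
  shows "star_chromatic_index V E \<le> k"
proof -
  define n where "n = length M"
  define c where "c i j = M ! i ! j" for i j
  \<comment> \<open>The default 0 keeps \<open>col\<close> symmetric beyond the matrix. On
    \<open>A\<close> the entries are positive, so subtracting 1 identifies no two of them.\<close>
  define col where "col i j = (if i < n \<and> j < n then c i j - 1 else 0)" for i j
  define A where "A i j \<longleftrightarrow> i < n \<and> j < n \<and> c i j > 0" for i j
  have all: "\<forall>i<n. \<forall>j<n. c i j = c j i \<and> c i j \<le> k \<and> (c i j > 0 \<longrightarrow>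
      (\<forall>l<n. c j l > 0 \<and> l \<noteq> i \<longrightarrow> c i j \<noteq> c j l \<and>
        (\<forall>h<n. c h i = c j l \<and> h \<noteq> j \<and> h \<noteq> l \<longrightarrow>
          (\<forall>p<n. c l p = c i j \<longrightarrow> p = i \<or> p = j))))"
    using M(1) by (simp only: star_matrix_def Let_def list_all_iff n_def c_def set_upt Ball_def
      atLeastLessThan_iff le0 simp_thms)
  have sym: "c i j = c j i" and le: "c i j \<le> k" if "i < n" "j < n" for i j
    using all that by blast+
  have proper: "c i j \<noteq> c j l" if "i < n" "j < n" "l < n" "c i j > 0" "c j l > 0" "l \<noteq> i" for i j l
    using all that by blast
  have star: "p = i \<or> p = j" if "i < n" "j < n" "l < n" "h < n" "p < n" "c i j > 0" "c j l > 0" "l \<noteq> i"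
    "c h i = c j l" "h \<noteq> j" "h \<noteq> l" "c l p = c i j" for h i j l p
    using all that by blast
  show ?thesis
  proof (rule star_chromatic_index_le[OF g ys, of A col])
    show "A i j" if "i < length ys" "j < length ys" "adj E (ys ! i) (ys ! j)" for i j
      using adj[OF that] that M(2) by (auto simp: A_def n_def c_def)
    show "col i j = col j i" for i j using sym by (auto simp: col_def)
    show "col i j < k" if "A i j" for i j using le[of i j] that by (auto simp: A_def col_def)
    show "col i j \<noteq> col j l" if "A i j" "A j l" "i \<noteq> l" for i j l
      using proper[of i j l] that by (auto simp: A_def col_def)
    show False if a: "A h i" "A i j" "A j l" "A l p" and d: "distinct [h, i, j, l]" "distinct [i, j, l, p]"
      and eq: "col h i = col j l" "col i j = col l p" for h i j l p
    proof -
      have "c h i = c j l" "c l p = c i j" using a eq by (auto simp: A_def col_def)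
      then show False using star[of i j l h p] a d by (auto simp: A_def)
    qed
  qed
qed

text \<open>Only the entry 3 occurs on two edges, while a bichromatic path or cycle with four edges
  needs two repeated colours.\<close>

lemma diamond_index:
  assumes "simple_graph V E" "distinct ys" "set ys = V" "length ys = 4"
    and fan: "\<And>i j. i < length ys \<Longrightarrow> j < length ys \<Longrightarrow> adj E (ys ! i) (ys ! j) \<Longrightarrow> fan_adj (length ys) i j"
  shows "star_chromatic_index V E \<le> 4"
proof (rule star_matrix_index[OF assms(1-3)])
  let ?M = "[[0,1,2,3], [1,0,3,0], [2,3,0,4], [3,0,4,0]] :: nat list list"
  show "star_matrix 4 ?M" by code_simp
  show "?M ! i ! j > 0" if "i < length ys" "j < length ys" "adj E (ys ! i) (ys ! j)" for i j
  proof -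
    have "fan_adj 4 i j" using fan[OF that] assms(4) by simp
    moreover have "i = 0 \<or> i = 1 \<or> i = 2 \<or> i = 3" "j = 0 \<or> j = 1 \<or> j = 2 \<or> j = 3"
      using that assms(4) by linarith+
    ultimately show ?thesis unfolding fan_adj_def by (elim disjE; simp)
  qed
qed (use assms(4) in simp)

text \<open>The inner spokes have the private entries 2, 3, 4, which no bichromatic path can use.
  Around the hexagon \<open>0, ..., 5\<close> the entries are 1, 5, 6, 1, 6, 5, and any four
  consecutive ones show all three values. A fan on five vertices is coloured inside the one on six,
  whence \<open>n + 1\<close> for \<open>n = 5\<close>.\<close>

lemma fan_index_small:
  assumes "simple_graph V E" "distinct ys" "set ys = V" "length ys \<le> 6"
    and fan: "\<And>i j. i < length ys \<Longrightarrow> j < length ys \<Longrightarrow> adj E (ys ! i) (ys ! j) \<Longrightarrow> fan_adj (length ys) i j"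
  shows "star_chromatic_index V E \<le> 6"
proof (rule star_matrix_index[OF assms(1-3)])
  let ?M = "[[0,1,2,3,4,5], [1,0,5,0,0,0], [2,5,0,6,0,0], [3,0,6,0,1,0], [4,0,0,1,0,6], [5,0,0,0,6,0]] :: nat list list"
  show "star_matrix 6 ?M" by code_simp
  show "?M ! i ! j > 0" if "i < length ys" "j < length ys" "adj E (ys ! i) (ys ! j)" for i j
  proof -
    have "fan_adj 6 i j" using fan[OF that] assms(4) by (auto simp: fan_adj_def)
    moreover have "i = 0 \<or> i = 1 \<or> i = 2 \<or> i = 3 \<or> i = 4 \<or> i = 5"
      "j = 0 \<or> j = 1 \<or> j = 2 \<or> j = 3 \<or> j = 4 \<or> j = 5" using that assms(4) by linarith+
    ultimately show ?thesis unfolding fan_adj_def by (elim disjE; simp)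
  qed
qed (use assms(4) in simp)

text \<open>\<open>s\<close> is the parity of the indices forming the triangle. Its edges have the
  private entries 4, 5, 6; around the hexagon any four consecutive entries show all of 1, 2, 3. The
  matrix for \<open>s = 1\<close> is the other one moved by one index.\<close>

lemma sun_index:
  assumes "simple_graph V E" "distinct ys" "set ys = V" "length ys = 6" "s = 0 \<or> s = 1"
    and sun: "\<And>i j. \<lbrakk>i < j; j < 6; adj E (ys ! i) (ys ! j)\<rbrakk> \<Longrightarrow>
      j = Suc i \<or> i = 0 \<and> j = 5 \<or> i mod 2 = s \<and> j mod 2 = s"
  shows "star_chromatic_index V E \<le> 6"
proof -
  have irr: "\<not> adj E v v" for v using assms(1) by (auto simp: simple_graph_def adj_def)
  have adj: "j = Suc i \<or> i = Suc j \<or> i = 0 \<and> j = 5 \<or> i = 5 \<and> j = 0 \<or> i \<noteq> j \<and> i mod 2 = s \<and> j mod 2 = s"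
    if "i < 6" "j < 6" "adj E (ys ! i) (ys ! j)" for i j
  proof (cases i j rule: linorder_cases)
    case less
    then show ?thesis using sun[of i j] that by auto
  next
    case greater
    then show ?thesis using sun[of j i] that adj_sym[of E "ys ! i"] by auto
  qed (use that irr in auto)
  have ij: "(i = 0 \<or> i = 1 \<or> i = 2 \<or> i = 3 \<or> i = 4 \<or> i = 5)" if "i < 6" for i :: nat using that by linarith
  from assms(5) show ?thesis
  proof
    assume s: "s = 0"
    let ?M = "[[0,1,4,0,6,3], [1,0,2,0,0,0], [4,2,0,1,5,0], [0,0,1,0,3,0], [6,0,5,3,0,2], [3,0,0,0,2,0]] :: nat list list"
    show ?thesis
    proof (rule star_matrix_index[OF assms(1-3), of 6 ?M])
      show "star_matrix 6 ?M" by code_simp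
      show "?M ! i ! j > 0" if "i < length ys" "j < length ys" "adj E (ys ! i) (ys ! j)" for i j
      proof -
        have l6: "i < 6" "j < 6" using that assms(4) by simp_all
        from adj[OF l6 that(3)] ij[OF l6(1)] ij[OF l6(2)] s show ?thesis
          by (elim disjE conjE; simp)
      qed
    qed (use assms(4) in simp)
  next
    assume s: "s = 1"
    let ?M = "[[0,3,0,0,0,2], [3,0,1,4,0,6], [0,1,0,2,0,0], [0,4,2,0,1,5], [0,0,0,1,0,3], [2,6,0,5,3,0]] :: nat list list"
    show ?thesis
    proof (rule star_matrix_index[OF assms(1-3), of 6 ?M])
      show "star_matrix 6 ?M" by code_simp
      show "?M ! i ! j > 0" if "i < length ys" "j < length ys" "adj E (ys ! i) (ys ! j)" for i j
      proof -
        have l6: "i < 6" "j < 6" using that assms(4) by simp_all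
        from adj[OF l6 that(3)] ij[OF l6(1)] ij[OF l6(2)] s show ?thesis
          by (elim disjE conjE; simp)
      qed
    qed (use assms(4) in simp)
  qed
qed

section \<open>Small cases and conclusion\<close>

text \<open>With the hub rotated to index 0, all other edges are cycle edges; the two cycle edges at
  the hub, including the closing one, count as spokes.\<close>

lemma hub_fan:
  assumes g: "simple_graph V E" and ys: "graph_cycle V E ys" "set ys = V" and h: "h < length ys"
    and hub: "\<And>i j. \<lbrakk>i < j; j < length ys; adj E (ys ! i) (ys ! j)\<rbrakk> \<Longrightarrow>
      j = Suc i \<or> i = 0 \<and> j = length ys - 1 \<or> i = h \<or> j = h"
  obtains zs where "distinct zs" "set zs = V" "length zs = length ys"
    "\<And>i j. \<lbrakk>i < length zs; j < length zs; adj E (zs ! i) (zs ! j)\<rbrakk> \<Longrightarrow> fan_adj (length zs) i j"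
proof -
  obtain zs where zs: "graph_cycle V E zs" "set zs = set ys" "length zs = length ys"
    "\<And>j. j < length ys \<Longrightarrow> zs ! j = ys ! ((h + j) mod length ys)"
    using graph_cycle_rotate_hd[OF ys(1) h] by blast
  have irr: "\<not> adj E v v" for v using g by (auto simp: simple_graph_def adj_def)
  let ?n = "length ys"
  \<comment> \<open>\<open>hub\<close> speaks of increasing pairs of the old indices, so the order
    is assumed after the rotation modulo \<open>?n\<close>.\<close>
  have main: "fan_adj ?n i j"
    if ij: "i < ?n" "j < ?n" and a: "adj E (zs ! i) (zs ! j)"
      and lt: "(h + i) mod ?n < (h + j) mod ?n" for i j
  proof -
    define p q where "p = (h + i) mod ?n" and "q = (h + j) mod ?n"
    have p: "p = h + i \<and> h + i < ?n \<or> p + ?n = h + i" and q: "q = h + j \<and> h + j < ?n \<or> q + ?n = h + j"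
      using ij h by (auto simp: p_def q_def mod_if)
    have "0 < ?n" using h by linarith
    then have "q < ?n" by (simp add: q_def)
    then have "q = Suc p \<or> p = 0 \<and> q = ?n - 1 \<or> p = h \<or> q = h"
      using hub[of p q] a lt zs(4) ij by (simp add: p_def q_def)
    moreover have "p < q" using lt by (simp add: p_def q_def)
    ultimately have "i = 0 \<or> j = 0 \<or> j = Suc i \<or> i = Suc j"
      using p q ij \<open>q < ?n\<close> h by linarith
    moreover have "i \<noteq> j" using a irr by auto
    ultimately show ?thesis using ij by (simp add: fan_adj_def)
  qed
  have "fan_adj ?n i j" if ij: "i < ?n" "j < ?n" and a: "adj E (zs ! i) (zs ! j)" for i j
  proof (cases "(h + i) mod ?n" "(h + j) mod ?n" rule: linorder_cases)
    case less
    then show ?thesis using main ij a by blast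
  next
    case equal
    then show ?thesis using a irr zs(4) ij by simp
  next
    case greater
    then have "fan_adj ?n j i" using main[of j i] ij a adj_sym[of E "zs ! i" "zs ! j"] by blast
    then show ?thesis by (auto simp: fan_adj_def)
  qed
  then show thesis using that[of zs] zs ys by (simp add: graph_cycle_def)
qed

text \<open>A chord away from the hub has a cycle vertex on the side opposite to \<open>h\<close>,
  and the edge from \<open>h\<close> to that vertex would cross it. The vertex is
  \<open>Suc i\<close>, 0 or the last index, depending on the position of \<open>h\<close>.\<close>

lemma dominating_hub:
  assumes "\<not> k23 E" and ys: "graph_cycle V E ys" "length ys \<ge> 5" and h: "h < length ys"
    and dom: "\<And>j. j < length ys \<Longrightarrow> j \<noteq> h \<Longrightarrow> adj E (ys ! h) (ys ! j)"
    and ij: "i < j" "j < length ys" "adj E (ys ! i) (ys ! j)"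
  shows "j = Suc i \<or> i = 0 \<and> j = length ys - 1 \<or> i = h \<or> j = h"
proof (rule ccontr)
  assume neg: "\<not> ?thesis"
  note nc = graph_cycle_noncrossing[OF assms(1) ys]
  have dom': "adj E (ys ! j) (ys ! h)" if "j < length ys" "j \<noteq> h" for j
    using dom[OF that] adj_sym[of E "ys ! h" "ys ! j"] by blast
  from neg ij consider "h < i" "Suc i < j" | "i < h" "h < j" "i > 0" | "i < h" "h < j" "j < length ys - 1" | "j < h" "Suc i < j"
    by linarith
  then show False
  proof cases
    case 1
    then show False using nc[of h i "Suc i" j] dom[of "Suc i"] ij by simp
  next
    case 2
    moreover have "0 < length ys" using h by linarith
    ultimately show False using nc[of 0 i h j] dom'[of 0] ij h by simp
  next
    case 3
    moreover from this have "length ys - 1 < length ys" by linarith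
    ultimately show False using nc[of i h j "length ys - 1"] dom[of "length ys - 1"] ij by simp
  next
    case 4
    then show False using nc[of i "Suc i" j h] dom'[of "Suc i"] ij h by simp
  qed
qed

text \<open>Chords of a pentagon without a common vertex cross. The five chords form a pentagram,
  itself a five-cycle, so pairwise intersecting ones all share a vertex.\<close>

lemma pentagon_hub:
  assumes "\<not> k23 E" "graph_cycle V E ys" "length ys = 5"
  shows "\<exists>h<5. \<forall>j<5. \<forall>i<j. adj E (ys ! i) (ys ! j) \<longrightarrow> j = Suc i \<or> i = 0 \<and> j = 4 \<or> i = h \<or> j = h"
proof -
  define A where "A i j = adj E (ys ! i) (ys ! j)" for i j
  have nc: "\<not> (A i k \<and> A j l)" if "i < j" "j < k" "k < l" "l < 5" for i j k l
    using graph_cycle_noncrossing[OF assms(1,2)] assms(3) that by (simp add: A_def)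
  have "\<not> (A 0 2 \<and> A 1 3)" "\<not> (A 0 2 \<and> A 1 4)" "\<not> (A 0 3 \<and> A 1 4)" "\<not> (A 0 3 \<and> A 2 4)" "\<not> (A 1 3 \<and> A 2 4)"
    using nc[of 0 1 2 3] nc[of 0 1 2 4] nc[of 0 1 3 4] nc[of 0 2 3 4] nc[of 1 2 3 4] by simp_all
  then have cases: "(\<not> A 1 3 \<and> \<not> A 1 4 \<and> \<not> A 2 4) \<or> (\<not> A 0 2 \<and> \<not> A 0 3 \<and> \<not> A 2 4) \<or> (\<not> A 0 3 \<and> \<not> A 1 3 \<and> \<not> A 1 4) \<or>
    (\<not> A 0 2 \<and> \<not> A 1 4 \<and> \<not> A 2 4) \<or> (\<not> A 0 2 \<and> \<not> A 0 3 \<and> \<not> A 1 3)"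
    by blast
  have pairs: "j = Suc i \<or> i = 0 \<and> j = 4 \<or> (i, j) \<in> {(0,2), (0,3), (1,3), (1,4), (2,4)}"
    if "i < j" "j < 5" for i j :: nat
  proof -
    have "i = 0 \<or> i = 1 \<or> i = 2 \<or> i = 3" "j = 1 \<or> j = 2 \<or> j = 3 \<or> j = 4" using that by linarith+
    then show ?thesis using that by (elim disjE; simp)
  qed
  have H: ?thesis if "h < 5" "\<forall>(i, j) \<in> {(0,2), (0,3), (1,3), (1,4), (2,4)}. A i j \<longrightarrow> i = h \<or> j = h" for h
  proof (intro exI[of _ h] conjI allI impI)
    fix i j :: nat assume "j < 5" "i < j" "adj E (ys ! i) (ys ! j)"
    then show "j = Suc i \<or> i = 0 \<and> j = 4 \<or> i = h \<or> j = h"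
      using pairs[of i j] bspec[OF that(2), of "(i, j)"] by (auto simp: A_def)
  qed (rule that(1))
  from cases show ?thesis
  proof (elim disjE, goal_cases)
    case 1 show ?case by (rule H[of 0]) (use 1 in simp_all)
  next
    case 2 show ?case by (rule H[of 1]) (use 2 in simp_all)
  next
    case 3 show ?case by (rule H[of 2]) (use 3 in simp_all)
  next
    case 4 show ?case by (rule H[of 3]) (use 4 in simp_all)
  next
    case 5 show ?case by (rule H[of 4]) (use 5 in simp_all)
  qed
qed

text \<open>Disjoint chords of a hexagon cross, except for three parallel pairs such as
  \<open>1 5\<close> and \<open>2 4\<close>. A parallel pair cuts off two opposite vertices, which
  then have distance three. The only triangles of chords are the two parity classes of
  indices.\<close>

lemma hexagon_chords:
  assumes g: "simple_graph V E" "connected_graph V E" "diameter V E = 2" "\<not> k23 E"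
    and ys: "graph_cycle V E ys" "set ys = V" "length ys = 6"
  shows "(\<exists>h<6. \<forall>j<6. \<forall>i<j. adj E (ys ! i) (ys ! j) \<longrightarrow> j = Suc i \<or> i = 0 \<and> j = 5 \<or> i = h \<or> j = h) \<or>
    (\<exists>s. (s = 0 \<or> s = 1) \<and> (\<forall>j<6. \<forall>i<j. adj E (ys ! i) (ys ! j) \<longrightarrow>
      j = Suc i \<or> i = 0 \<and> j = 5 \<or> i mod 2 = s \<and> j mod 2 = s))"
proof -
  define A where "A i j = adj E (ys ! i) (ys ! j)" for i j
  have sym: "A i j = A j i" for i j by (simp add: A_def adj_sym)
  have irr: "\<not> A i i" for i using g(1) by (auto simp: simple_graph_def adj_def A_def)
  have nc: "\<not> (A i k \<and> A j l)" if "i < j" "j < k" "k < l" "l < 6" for i j k l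
    using graph_cycle_noncrossing[OF g(4) ys(1)] ys(3) that by (simp add: A_def)
  have six: "i = 0 \<or> i = 1 \<or> i = 2 \<or> i = 3 \<or> i = 4 \<or> i = 5" if "i < 6" for i :: nat using that by linarith
  have diam: "A i j \<or> (A i 0 \<and> A 0 j) \<or> (A i 1 \<and> A 1 j) \<or> (A i 2 \<and> A 2 j) \<or> (A i 3 \<and> A 3 j) \<or>
    (A i 4 \<and> A 4 j) \<or> (A i 5 \<and> A 5 j)" if "i < 6" "j < 6" "i \<noteq> j" for i j
  proof (cases "A i j")
    case False
    have "ys ! i \<noteq> ys ! j" using that ys by (simp add: graph_cycle_def nth_eq_iff_index_eq)
    moreover have "ys ! i \<in> V" "ys ! j \<in> V" using that ys nth_mem by force+
    ultimately obtain w where "w \<in> V" "adj E (ys ! i) w" "adj E w (ys ! j)"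
      using diameter_two_common_neighbor[OF g(1-3)] False unfolding A_def by blast
    then obtain m where "m < 6" "A i m" "A m j" using ys unfolding A_def by (metis in_set_conv_nth)
    then show ?thesis using six by blast
  qed simp
  have cross: "\<not> (A 0 2 \<and> A 1 3)" "\<not> (A 0 2 \<and> A 1 4)" "\<not> (A 0 2 \<and> A 1 5)"
    "\<not> (A 0 3 \<and> A 1 4)" "\<not> (A 0 3 \<and> A 1 5)" "\<not> (A 0 3 \<and> A 2 4)" "\<not> (A 0 3 \<and> A 2 5)"
    "\<not> (A 0 4 \<and> A 1 5)" "\<not> (A 0 4 \<and> A 2 5)" "\<not> (A 0 4 \<and> A 3 5)"
    "\<not> (A 1 3 \<and> A 2 4)" "\<not> (A 1 3 \<and> A 2 5)" "\<not> (A 1 4 \<and> A 2 5)" "\<not> (A 1 4 \<and> A 3 5)" "\<not> (A 2 4 \<and> A 3 5)"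
    using nc[of 0 1 2 3] nc[of 0 1 2 4] nc[of 0 1 2 5] nc[of 0 1 3 4] nc[of 0 1 3 5] nc[of 0 2 3 4]
      nc[of 0 2 3 5] nc[of 0 1 4 5] nc[of 0 2 4 5] nc[of 0 3 4 5] nc[of 1 2 3 4] nc[of 1 2 3 5]
      nc[of 1 2 4 5] nc[of 1 3 4 5] nc[of 2 3 4 5] by simp_all
  have flip: "A 3 1 = A 1 3" "A 4 1 = A 1 4" "A 5 1 = A 1 5" "A 2 0 = A 0 2" "A 3 0 = A 0 3" "A 4 0 = A 0 4"
    "A 4 2 = A 2 4" "A 5 2 = A 2 5" "A 5 3 = A 3 5" by (rule sym)+
  have d03: "A 0 3 \<or> (A 0 1 \<and> A 1 3) \<or> (A 0 2 \<and> A 2 3) \<or> (A 0 4 \<and> A 4 3) \<or> (A 0 5 \<and> A 5 3)"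
    using diam[of 0 3] irr by simp
  have d14: "A 1 4 \<or> (A 1 0 \<and> A 0 4) \<or> (A 1 2 \<and> A 2 4) \<or> (A 1 3 \<and> A 3 4) \<or> (A 1 5 \<and> A 5 4)"
    using diam[of 1 4] irr by simp
  have d25: "A 2 5 \<or> (A 2 0 \<and> A 0 5) \<or> (A 2 1 \<and> A 1 5) \<or> (A 2 3 \<and> A 3 5) \<or> (A 2 4 \<and> A 4 5)"
    using diam[of 2 5] irr by simp
  have "\<not> (A 1 5 \<and> A 2 4)" "\<not> (A 0 2 \<and> A 3 5)" "\<not> (A 1 3 \<and> A 0 4)"
    using d03 d14 d25 cross flip by argo+
  \<comment> \<open>Pairwise intersecting chords share a vertex or form a triangle.\<close>
  with cross have cases:
    "(\<not> A 1 3 \<and> \<not> A 1 4 \<and> \<not> A 1 5 \<and> \<not> A 2 4 \<and> \<not> A 2 5 \<and> \<not> A 3 5) \<or>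
     (\<not> A 0 2 \<and> \<not> A 0 3 \<and> \<not> A 0 4 \<and> \<not> A 2 4 \<and> \<not> A 2 5 \<and> \<not> A 3 5) \<or>
     (\<not> A 1 3 \<and> \<not> A 1 4 \<and> \<not> A 1 5 \<and> \<not> A 0 3 \<and> \<not> A 0 4 \<and> \<not> A 3 5) \<or>
     (\<not> A 0 2 \<and> \<not> A 0 4 \<and> \<not> A 1 4 \<and> \<not> A 1 5 \<and> \<not> A 2 4 \<and> \<not> A 2 5) \<or>
     (\<not> A 0 2 \<and> \<not> A 0 3 \<and> \<not> A 1 3 \<and> \<not> A 1 5 \<and> \<not> A 2 5 \<and> \<not> A 3 5) \<or>
     (\<not> A 0 2 \<and> \<not> A 0 3 \<and> \<not> A 0 4 \<and> \<not> A 1 3 \<and> \<not> A 1 4 \<and> \<not> A 2 4) \<or>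
     (\<not> A 0 3 \<and> \<not> A 1 3 \<and> \<not> A 1 4 \<and> \<not> A 1 5 \<and> \<not> A 2 5 \<and> \<not> A 3 5) \<or>
     (\<not> A 0 2 \<and> \<not> A 0 3 \<and> \<not> A 0 4 \<and> \<not> A 1 4 \<and> \<not> A 2 4 \<and> \<not> A 2 5)"
    by metis
  have pairs: "j = Suc i \<or> i = 0 \<and> j = 5 \<or> (i, j) \<in> {(0,2), (0,3), (0,4), (1,3), (1,4), (1,5), (2,4), (2,5), (3,5)}"
    if "i < j" "j < 6" for i j :: nat
  proof -
    have "i = 0 \<or> i = 1 \<or> i = 2 \<or> i = 3 \<or> i = 4" "j = 1 \<or> j = 2 \<or> j = 3 \<or> j = 4 \<or> j = 5"
      using that by linarith+
    then show ?thesis using that by (elim disjE; simp)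
  qed
  have chords: "\<forall>j<6. \<forall>i<j. A i j \<longrightarrow> j = Suc i \<or> i = 0 \<and> j = 5 \<or> P i j"
    if "\<forall>(i, j) \<in> {(0,2), (0,3), (0,4), (1,3), (1,4), (1,5), (2,4), (2,5), (3,5)}. A i j \<longrightarrow> P i j" for P
  proof (intro allI impI)
    fix i j :: nat assume "j < 6" "i < j" "A i j"
    then show "j = Suc i \<or> i = 0 \<and> j = 5 \<or> P i j" using pairs[of i j] bspec[OF that, of "(i, j)"] by auto
  qed
  have H: ?thesis if "h < 6"
    "\<forall>(i, j) \<in> {(0,2), (0,3), (0,4), (1,3), (1,4), (1,5), (2,4), (2,5), (3,5)}. A i j \<longrightarrow> i = h \<or> j = h" for h
    using chords[OF that(2)] that(1) unfolding A_def by blast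
  have S: ?thesis if "s = 0 \<or> s = 1"
    "\<forall>(i, j) \<in> {(0,2), (0,3), (0,4), (1,3), (1,4), (1,5), (2,4), (2,5), (3,5)}. A i j \<longrightarrow> i mod 2 = s \<and> j mod 2 = s" for s
    using chords[OF that(2)] that(1) unfolding A_def by blast
  from cases show ?thesis
  proof (elim disjE, goal_cases)
    case 1 show ?case by (rule H[of 0]) (use 1 in simp_all)
  next
    case 2 show ?case by (rule H[of 1]) (use 2 in simp_all)
  next
    case 3 show ?case by (rule H[of 2]) (use 3 in simp_all)
  next
    case 4 show ?case by (rule H[of 3]) (use 4 in simp_all)
  next
    case 5 show ?case by (rule H[of 4]) (use 5 in simp_all)
  next
    case 6 show ?case by (rule H[of 5]) (use 6 in simp_all)
  next
    case 7 show ?case by (rule S[of 0]) (use 7 in simp_all)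
  next
    case 8 show ?case by (rule S[of 1]) (use 8 in simp_all)
  qed
qed

text \<open>Both diagonals together would make the graph complete, of diameter at most 1.\<close>

lemma quadrilateral_hub:
  assumes g: "simple_graph V E" "diameter V E = 2" and ys: "graph_cycle V E ys" "set ys = V" "length ys = 4"
  shows "\<exists>h<4. \<forall>j<4. \<forall>i<j. adj E (ys ! i) (ys ! j) \<longrightarrow> j = Suc i \<or> i = 0 \<and> j = 3 \<or> i = h \<or> j = h"
proof -
  define A where "A i j = adj E (ys ! i) (ys ! j)" for i j
  have sym: "A i j = A j i" for i j by (simp add: A_def adj_sym)
  have pairs: "j = Suc i \<or> i = 0 \<and> j = 3 \<or> i = 0 \<and> j = 2 \<or> i = 1 \<and> j = 3"
    if "i < j" "j < 4" for i j :: nat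
  proof -
    have "i = 0 \<or> i = 1 \<or> i = 2" "j = 1 \<or> j = 2 \<or> j = 3" using that by linarith+
    then show ?thesis using that by (elim disjE; simp)
  qed
  have cyc: "A i (Suc i)" if "Suc i < 4" for i using graph_cycle_adj(1)[OF ys(1)] ys(3) that by (simp add: A_def)
  have cyc': "A 0 3" using graph_cycle_adj(2)[OF ys(1)] ys(3) by (simp add: A_def)
  have "\<not> (A 0 2 \<and> A 1 3)"
  proof
    assume "A 0 2 \<and> A 1 3"
    then have lt: "A i j" if "i < j" "j < 4" for i j using pairs[OF that] cyc[of i] cyc' that by auto
    have "A i j" if "i < 4" "j < 4" "i \<noteq> j" for i j
      using lt[of i j] lt[of j i] that sym[of i j] by (cases "i < j") auto
    moreover have "V \<noteq> {}" using ys by auto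
    then obtain u v where uv: "u \<in> V" "v \<in> V" "u \<noteq> v" "\<not> adj E u v"
      using diameter_two_nonadjacent[OF g(1) _ g(2)] by blast
    moreover obtain i j where "i < 4" "u = ys ! i" "j < 4" "v = ys ! j"
      using uv ys by (metis in_set_conv_nth)
    ultimately show False unfolding A_def by metis
  qed
  then consider "\<not> A 1 3" | "\<not> A 0 2" by blast
  then show ?thesis
  proof cases
    case 1
    have "j = Suc i \<or> i = 0 \<and> j = 3 \<or> i = 0 \<or> j = 0" if "i < j" "j < 4" "A i j" for i j
      using pairs[OF that(1,2)] that(3) 1 by auto
    then show ?thesis unfolding A_def by (intro exI[of _ 0]) simp
  next
    case 2
    have "j = Suc i \<or> i = 0 \<and> j = 3 \<or> i = 1 \<or> j = 1" if "i < j" "j < 4" "A i j" for i j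
      using pairs[OF that(1,2)] that(3) 2 by auto
    then show ?thesis unfolding A_def by (intro exI[of _ 1]) simp
  qed
qed

theorem theorem2p6:
  fixes V :: "'a set" and E :: "'a set set" and n :: nat
  assumes "simple_graph V E"
    and "card V = n" and "n \<ge> 4"
    and "two_connected V E"
    and "outerplanar V E"
    and "diameter V E = 2"
  shows "max_degree V E \<le> star_chromatic_index V E \<and>
         star_chromatic_index V E \<le>
           (if n = 5 then n + 1 else if n \<le> 7 then n else max_degree V E)"
proof
  have fV: "finite V" and neV: "V \<noteq> {}" using assms(1-3) by (auto simp: simple_graph_def)
  show "max_degree V E \<le> star_chromatic_index V E"
    using max_degree_le_star_chromatic_index[OF assms(1) neV] .
  have k: "\<not> k23 E" by (rule outerplanar_no_k23[OF assms(1,5)])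
  have con: "connected_graph V E" using assms(4) by (simp add: two_connected_def)
  obtain ys where ys: "graph_cycle V E ys" "set ys = V"
    using two_connected_hamiltonian[OF assms(1,4) k] by blast
  have len: "length ys = n" using ys assms(2) by (metis graph_cycle_def distinct_card)
  note hub = hub_fan[OF assms(1) ys]
  consider "n = 4" | "n = 5" | "n = 6" | "n \<ge> 7" using assms(3) by linarith
  then show "star_chromatic_index V E \<le> (if n = 5 then n + 1 else if n \<le> 7 then n else max_degree V E)"
  proof cases
    case 1
    obtain h where "h < 4" "\<forall>j<4. \<forall>i<j. adj E (ys ! i) (ys ! j) \<longrightarrow> j = Suc i \<or> i = 0 \<and> j = 3 \<or> i = h \<or> j = h"
      using quadrilateral_hub[OF assms(1,6) ys] len 1 by auto
    then obtain zs where "distinct zs" "set zs = V" "length zs = length ys"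
      "\<And>i j. \<lbrakk>i < length zs; j < length zs; adj E (zs ! i) (zs ! j)\<rbrakk> \<Longrightarrow> fan_adj (length zs) i j"
      using hub[of h] len 1 by auto
    then have "star_chromatic_index V E \<le> 4" using len 1 by (intro diamond_index[OF assms(1), of zs]) auto
    then show ?thesis using 1 by simp
  next
    case 2
    obtain h where "h < 5" "\<forall>j<5. \<forall>i<j. adj E (ys ! i) (ys ! j) \<longrightarrow> j = Suc i \<or> i = 0 \<and> j = 4 \<or> i = h \<or> j = h"
      using pentagon_hub[OF k ys(1)] len 2 by auto
    then obtain zs where "distinct zs" "set zs = V" "length zs = length ys"
      "\<And>i j. \<lbrakk>i < length zs; j < length zs; adj E (zs ! i) (zs ! j)\<rbrakk> \<Longrightarrow> fan_adj (length zs) i j"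
      using hub[of h] len 2 by auto
    then have "star_chromatic_index V E \<le> 6" using len 2 by (intro fan_index_small[OF assms(1), of zs]) auto
    then show ?thesis using 2 by simp
  next
    case 3
    have "star_chromatic_index V E \<le> 6"
    proof (cases "\<exists>h<6. \<forall>j<6. \<forall>i<j. adj E (ys ! i) (ys ! j) \<longrightarrow> j = Suc i \<or> i = 0 \<and> j = 5 \<or> i = h \<or> j = h")
      case True
      then obtain h where "h < 6" "\<forall>j<6. \<forall>i<j. adj E (ys ! i) (ys ! j) \<longrightarrow> j = Suc i \<or> i = 0 \<and> j = 5 \<or> i = h \<or> j = h"
        by blast
      then obtain zs where "distinct zs" "set zs = V" "length zs = length ys"
        "\<And>i j. \<lbrakk>i < length zs; j < length zs; adj E (zs ! i) (zs ! j)\<rbrakk> \<Longrightarrow> fan_adj (length zs) i j"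
        using hub[of h] len 3 by auto
      then show ?thesis using len 3 by (intro fan_index_small[OF assms(1), of zs]) auto
    next
      case False
      then obtain s where "s = 0 \<or> s = 1" "\<forall>j<6. \<forall>i<j. adj E (ys ! i) (ys ! j) \<longrightarrow>
          j = Suc i \<or> i = 0 \<and> j = 5 \<or> i mod 2 = s \<and> j mod 2 = s"
        using hexagon_chords[OF assms(1) con assms(6) k ys] len 3 by auto
      then show ?thesis using len 3 ys by (intro sun_index[OF assms(1), of ys s]) (auto simp: graph_cycle_def)
    qed
    then show ?thesis using 3 by simp
  next
    case 4
    obtain v where v: "v \<in> V" "\<forall>u\<in>V. u \<noteq> v \<longrightarrow> adj E v u"
      using diameter_two_dominating[OF assms(1) con assms(6) k ys] len 4 by auto
    then obtain h where h: "h < length ys" "ys ! h = v" using ys by (metis in_set_conv_nth)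
    have dom: "adj E (ys ! h) (ys ! j)" if "j < length ys" "j \<noteq> h" for j
    proof -
      have "ys ! j \<noteq> v" using that h ys(1) by (auto simp: graph_cycle_def nth_eq_iff_index_eq)
      then show ?thesis using v that ys h by (metis nth_mem)
    qed
    obtain zs where zs: "distinct zs" "set zs = V" "length zs = length ys"
      "\<And>i j. \<lbrakk>i < length zs; j < length zs; adj E (zs ! i) (zs ! j)\<rbrakk> \<Longrightarrow> fan_adj (length zs) i j"
    proof (rule hub[OF h(1)])
      show "j = Suc i \<or> i = 0 \<and> j = length ys - 1 \<or> i = h \<or> j = h"
        if "i < j" "j < length ys" "adj E (ys ! i) (ys ! j)" for i j
        by (rule dominating_hub[OF k ys(1) _ h(1) dom that]) (use len 4 in auto)
    qed blast
    \<comment> \<open>Used with \<open>m = 7\<close> for seven vertices and with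
      \<open>m = n - 1\<close>, the number of spokes and thus the degree of the hub, from eight
      on.\<close>
    have idx: "star_chromatic_index V E \<le> m" if "n \<le> Suc m" "m \<ge> 7" for m
      using fan_index_large[OF assms(1) zs(1,2), of m] zs(3,4) len that by simp
    show ?thesis
    proof (cases "n = 7")
      case True
      then show ?thesis using idx[of 7] by simp
    next
      case False
      have "V - {v} \<subseteq> {u. {v, u} \<in> E}" using v by (auto simp: adj_def)
      moreover have "{u. {v, u} \<in> E} \<subseteq> V" using assms(1) by (auto simp: simple_graph_def)
      ultimately have "card (V - {v}) \<le> degree E v"
        unfolding degree_def using fV by (intro card_mono) (auto intro: finite_subset)
      then have "n - 1 \<le> degree E v" using v fV assms(2) by simp
      also have "\<dots> \<le> max_degree V E" unfolding max_degree_def using v fV by (intro Max_ge) auto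
      finally have "n - 1 \<le> max_degree V E" .
      moreover have "star_chromatic_index V E \<le> n - 1" using idx[of "n - 1"] 4 False by simp
      ultimately show ?thesis using 4 False by simp
    qed
  qed
qed

end
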